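(* For every $n\ge1$, the poset $\mathcal{FL}yn_n^\bullet$ of pointed Lyndon forests is a Whitney dual of $\Pi_n^\bullet$. In particular, $\mathcal{FL}yn_n^\bullet\cong R_{\lambda_\bullet}(\Pi_n^\bullet)$.
   Context: Pointed partitions: a pointed set is $A^p$ with $A$ nonempty finite, $p\in A$; a pointed partition of $[n]$ is a collection of pointed sets whose underlying sets partition $[n]$. In $\Pi_n^\bullet$, $\pi\lessdot\pi'$ when $\pi'$ arises by replacing two blocks $A^p,B^q$ ($\min A<\min B$) by $(A\cup B)^p$ (1-merge) or $(A\cup B)^q$ (0-merge); $\hat0$ is the partition into singletons. $\lambda_\bullet$ labels a $u$-merge by $(\min A,\min B)^u\in\Lambda_n^\bullet$, where $\Lambda_n^\bullet$ has elements $(a,b)^u$ ($1\le a<b\le n$, $u\in\{0,1\}$), ordered as the ordinal sum $A_1\oplus C_1\oplus\cdots\oplus A_{n-1}\oplus C_{n-1}$, $A_a$ the antichain $\{(a,b)^0\}$, $C_a$ the chain $\{(a,b)^1\}$ with $(a,b)^1<(a,c)^1$ iff $b<c$. $R_\lambda(P)$: for a word $w$ over a poset of labels, $\mathrm{sort}(w)$ is obtained by repeatedly taking the smallest index $i$ with $w_i<w_{i+1}$ and swapping $w_i,w_{i+1}$ until no such index exists. For a poset $P$ with edge labeling $\lambda$, $R_\lambda(P)$ is the set of pairs $(x,w)$ with $x\in P$ and $w$ the label sequence of an ascent-free saturated chain from $\hat0$ to $x$ (ascent-free: no consecutive labels with $\ell_i<\ell_{i+1}$), with $(x,w)\lessdot(y,u)$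 iff $x\lessdot y$ in $P$ and $u=\mathrm{sort}(w\,\lambda(x\lessdot y))$. Trees: a bicolored binary forest on $[n]$ is a forest of rooted planar binary trees (internal vertices have left child $L(v)$ and right child $R(v)$) with leaves bijectively labeled by $[n]$ and each internal vertex colored $\mathrm{color}(v)\in\{0,1\}$. The valency $\nu(v)$ is the smallest leaf label below $v$; the forest is normalized if $\nu(v)=\nu(L(v))$ for all internal $v$; an internal $v$ is Lyndon if $L(v)$ is a leaf or $\nu(R(L(v)))>\nu(R(v))$. A normalized bicolored binary tree is a pointed Lyndon tree if every internal $v$ with internal left child satisfies $\mathrm{color}(L(v))\ge\mathrm{color}(v)$ and, when $\mathrm{color}(L(v))=\mathrm{color}(v)=1$, $v$ is Lyndon; a pointed Lyndon forest has all components pointed Lyndon trees. To $u$-merge two pointed Lyndon trees $T_1,T_2$ (minimum leaf of $T_1$ less than that of $T_2$), create a new vertex $r$ of color $u$ with left child the root of $T_1$ and right child the root of $T_2$; while the result is not a pointed Lyndon tree, slide $r$ past its left child: if $r$ has left child $x$ with subtrees $X_L,X_R$ and right subtree $Y$, replace the subtree $r(x(X_L,X_R),Y)$ by $x(r(X_L,Y),X_R)$ (colors kept). This terminates in a pointed Lyndon tree. $\mathcal{FL}yn_n^\bullet$ is the set of pointed Lyndon forests on $[n]$ with $F\lessdot F'$ iff $F'$ is obtained from $F$ by $u$-merging exactly two of its trees for some $u\in\{0,1\}$. Whitney numbers of a graded poset with $\hat0$: $w_k(P)=\sum_{\rho(x)=k}\mu(\hat0,x)$, $W_k(P)=\#\{x:\rho(x)=k\}$;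 $P,Q$ are Whitney duals if $|w_k(P)|=W_k(Q)$ and $|w_k(Q)|=W_k(P)$ for all $k$. *)

theory Defs
  imports "HOL-Library.While_Combinator" "HOL-Library.Disjoint_Sets"
begin

text \<open>
  A poset is given by its reflexive order relation, whose field is the underlying set.  Colours
  and merge types \<open>u \<in> {0, 1}\<close> are Booleans: \<open>True\<close> stands for 1 and \<open>False\<close> for 0, so
  that the order on \<open>bool\<close> is the order \<open>0 < 1\<close>.
\<close>

section \<open>Graded posets and Whitney duality\<close>

definition poset_gen :: "'a set \<Rightarrow> ('a \<Rightarrow> 'a \<Rightarrow> bool) \<Rightarrow> 'a rel" where
  "poset_gen A R = {(x, y). x \<in> A \<and> y \<in> A \<and> (x, y) \<in> {(x, y). x \<in> A \<and> y \<in> A \<and> R x y}\<^sup>*}"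

lemma Field_poset_gen [simp]: "Field (poset_gen A R) = A"
  by (auto simp: poset_gen_def Field_def)

definition covers :: "'a rel \<Rightarrow> 'a \<Rightarrow> 'a \<Rightarrow> bool" where
  "covers r x y \<longleftrightarrow> (x, y) \<in> r \<and> x \<noteq> y \<and>
     (\<forall>z. (x, z) \<in> r \<and> (z, y) \<in> r \<longrightarrow> z = x \<or> z = y)"

definition is_bottom :: "'a rel \<Rightarrow> 'a \<Rightarrow> bool" where
  "is_bottom r z \<longleftrightarrow> z \<in> Field r \<and> (\<forall>x\<in>Field r. (z, x) \<in> r)"

text \<open>A saturated chain is the nonempty list of its elements, from bottom to top.\<close>

definition saturated_chain :: "'a rel \<Rightarrow> 'a \<Rightarrow> 'a \<Rightarrow> 'a list \<Rightarrow> bool" where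
  "saturated_chain r x y c \<longleftrightarrow>
     c \<noteq> [] \<and> set c \<subseteq> Field r \<and> successively (covers r) c \<and> hd c = x \<and> last c = y"

definition graded_poset :: "'a rel \<Rightarrow> bool" where
  "graded_poset r \<longleftrightarrow> Partial_order r \<and> finite (Field r) \<and> (\<exists>z. is_bottom r z) \<and>
     (\<forall>z x c d. is_bottom r z \<and> saturated_chain r z x c \<and> saturated_chain r z x d
        \<longrightarrow> length c = length d)"

definition rank :: "'a rel \<Rightarrow> 'a \<Rightarrow> nat" where
  "rank r x = (THE k. \<exists>z c. is_bottom r z \<and> saturated_chain r z x c \<and> length c = Suc k)"

text \<open>
  The guard on \<open>r\<close> makes the usual recursion terminate; the value 0 outside of it is a dummy.
\<close>

function mobius :: "'a rel \<Rightarrow> 'a \<Rightarrow> 'a \<Rightarrow> int" where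
  "mobius r x y =
     (if Partial_order r \<and> finite (Field r) \<and> (x, y) \<in> r
      then if x = y then 1
           else - (\<Sum>z | (x, z) \<in> r \<and> (z, y) \<in> r \<and> z \<noteq> y. mobius r x z)
      else 0)"
  by auto
termination
proof (relation "measure (\<lambda>(r, x, y). card {z. (z, y) \<in> r})", goal_cases)
  case 1
  then show ?case by simp
next
  case (2 r x y z)
  then have po: "Partial_order r" and fin: "finite (Field r)"
    and zy: "(z, y) \<in> r" "z \<noteq> y" and xy: "(x, y) \<in> r" by auto
  have "finite {w. (w, y) \<in> r}"
    by (rule finite_subset[OF _ fin]) (auto simp: Field_def)
  moreover have "{w. (w, z) \<in> r} \<subseteq> {w. (w, y) \<in> r}"
    using po zy by (auto simp: partial_order_on_def preorder_on_def dest: transD)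
  moreover have "(y, y) \<in> r"
    using po zy by (auto simp: partial_order_on_def preorder_on_def refl_on_def Field_def)
  moreover have "(y, z) \<notin> r"
    using po zy by (auto simp: partial_order_on_def dest: antisymD)
  ultimately have "card {w. (w, z) \<in> r} < card {w. (w, y) \<in> r}"
    by (intro psubset_card_mono) auto
  then show ?case by simp
qed

declare mobius.simps [simp del]

definition whitney_first :: "'a rel \<Rightarrow> nat \<Rightarrow> int" where
  "whitney_first r k = (\<Sum>x | x \<in> Field r \<and> rank r x = k. mobius r (THE z. is_bottom r z) x)"

definition whitney_second :: "'a rel \<Rightarrow> nat \<Rightarrow> nat" where
  "whitney_second r k = card {x \<in> Field r. rank r x = k}"

definition whitney_duals :: "'a rel \<Rightarrow> 'b rel \<Rightarrow> bool" where
  "whitney_duals r s \<longleftrightarrow> graded_poset r \<and> graded_poset s \<and>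
     (\<forall>k. \<bar>whitney_first r k\<bar> = int (whitney_second s k) \<and>
          \<bar>whitney_first s k\<bar> = int (whitney_second r k))"

text \<open>
  The library's \<open>iso\<close> is introduced for well-orders, but for arbitrary relations it
  is an isomorphism of relations.
\<close>

definition poset_isomorphic :: "'a rel \<Rightarrow> 'b rel \<Rightarrow> bool" where
  "poset_isomorphic r s \<longleftrightarrow> (\<exists>f. iso r s f)"

lemma poset_isomorphic_iff:
  "poset_isomorphic r s \<longleftrightarrow>
     (\<exists>f. bij_betw f (Field r) (Field s) \<and>
          (\<forall>x\<in>Field r. \<forall>y\<in>Field r. (x, y) \<in> r \<longleftrightarrow> (f x, f y) \<in> s))"
  by (simp add: poset_isomorphic_def iso_iff2)

section \<open>The poset of ascent-free label words\<close>

text \<open>Here \<open>lt\<close> is the strict order on labels and \<open>lam\<close> the edge labeling.\<close>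

definition ascent_free :: "('l \<Rightarrow> 'l \<Rightarrow> bool) \<Rightarrow> 'l list \<Rightarrow> bool" where
  "ascent_free lt w \<longleftrightarrow> (\<forall>i. Suc i < length w \<longrightarrow> \<not> lt (w ! i) (w ! Suc i))"

definition swap_first_ascent :: "('l \<Rightarrow> 'l \<Rightarrow> bool) \<Rightarrow> 'l list \<Rightarrow> 'l list" where
  "swap_first_ascent lt w =
     (let i = (LEAST i. Suc i < length w \<and> lt (w ! i) (w ! Suc i))
      in w[i := w ! Suc i, Suc i := w ! i])"

definition sort_word :: "('l \<Rightarrow> 'l \<Rightarrow> bool) \<Rightarrow> 'l list \<Rightarrow> 'l list" where
  "sort_word lt = while (\<lambda>w. \<not> ascent_free lt w) (swap_first_ascent lt)"

definition label_word :: "('a \<Rightarrow> 'a \<Rightarrow> 'l) \<Rightarrow> 'a list \<Rightarrow> 'l list" where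
  "label_word lam c = map2 lam (butlast c) (tl c)"

definition R_elems ::
    "('l \<Rightarrow> 'l \<Rightarrow> bool) \<Rightarrow> ('a \<Rightarrow> 'a \<Rightarrow> 'l) \<Rightarrow> 'a rel \<Rightarrow> ('a \<times> 'l list) set" where
  "R_elems lt lam r =
     {(x, w). \<exists>z c. is_bottom r z \<and> saturated_chain r z x c \<and> w = label_word lam c \<and>
        ascent_free lt w}"

definition R_poset ::
    "('l \<Rightarrow> 'l \<Rightarrow> bool) \<Rightarrow> ('a \<Rightarrow> 'a \<Rightarrow> 'l) \<Rightarrow> 'a rel \<Rightarrow> ('a \<times> 'l list) rel" where
  "R_poset lt lam r =
     poset_gen (R_elems lt lam r)
       (\<lambda>(x, w) (y, v). covers r x y \<and> v = sort_word lt (w @ [lam x y]))"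

section \<open>Pointed partitions\<close>

text \<open>The pair \<open>(A, p)\<close> is the pointed set \<open>A\<^sup>p\<close>.\<close>

type_synonym pointed_partition = "(nat set \<times> nat) set"

definition pointed_partitions :: "nat \<Rightarrow> pointed_partition set" where
  "pointed_partitions n =
     {\<pi>. (\<forall>(A, p)\<in>\<pi>. p \<in> A) \<and> inj_on fst \<pi> \<and> partition_on {1..n} (fst ` \<pi>)}"

text \<open>The triple \<open>(a, b, u)\<close> is the label \<open>(a, b)\<^sup>u\<close>.\<close>

type_synonym label = "nat \<times> nat \<times> bool"

definition pp_merge :: "pointed_partition \<Rightarrow> label \<Rightarrow> pointed_partition \<Rightarrow> bool" where
  "pp_merge \<pi> l \<pi>' \<longleftrightarrow>
     (\<exists>A p B q u. (A, p) \<in> \<pi> \<and> (B, q) \<in> \<pi> \<and> Min A < Min B \<and> l = (Min A, Min B, u) \<and>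
        \<pi>' = insert (A \<union> B, if u then p else q) (\<pi> - {(A, p), (B, q)}))"

definition Pi_pointed :: "nat \<Rightarrow> pointed_partition rel" where
  "Pi_pointed n = poset_gen (pointed_partitions n) (\<lambda>\<pi> \<pi>'. \<exists>l. pp_merge \<pi> l \<pi>')"

text \<open>
  The label of a cover is unique: \<open>\<pi> - \<pi>'\<close> consists of the two merged blocks, and
  their points are distinct.
\<close>

definition lambda_pointed :: "pointed_partition \<Rightarrow> pointed_partition \<Rightarrow> label" where
  "lambda_pointed \<pi> \<pi>' = (THE l. pp_merge \<pi> l \<pi>')"

text \<open>
  The ordinal sum \<open>A\<^sub>1 \<oplus> C\<^sub>1 \<oplus> A\<^sub>2 \<oplus> C\<^sub>2 \<oplus> \<dots>\<close>, with \<open>(a, b)\<^sup>0\<close> in the antichain \<open>A\<^sub>a\<close>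
  and \<open>(a, b)\<^sup>1\<close> in the chain \<open>C\<^sub>a\<close>.  Labels with \<open>1 \<le> a < b \<le> n\<close> form
  \<open>\<Lambda>\<^sub>n\<close>, and only those label edges of \<open>Pi_pointed n\<close>.
\<close>

fun label_less :: "label \<Rightarrow> label \<Rightarrow> bool" where
  "label_less (a, b, u) (a', b', u') \<longleftrightarrow>
     a < a' \<or> (a = a' \<and> \<not> u \<and> u') \<or> (a = a' \<and> u \<and> u' \<and> b < b')"

section \<open>Pointed Lyndon forests\<close>

datatype btree = is_Leaf: Leaf nat | Node (color: bool) (left: btree) (right: btree)

fun leaves :: "btree \<Rightarrow> nat list" where
  "leaves (Leaf a) = [a]"
| "leaves (Node u l r) = leaves l @ leaves r"

definition valency :: "btree \<Rightarrow> nat" where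
  "valency t = Min (set (leaves t))"

text \<open>\<open>internal_subtrees t\<close> are the subtrees rooted at the internal vertices of \<open>t\<close>.\<close>

fun internal_subtrees :: "btree \<Rightarrow> btree set" where
  "internal_subtrees (Leaf a) = {}"
| "internal_subtrees (Node u l r) =
     insert (Node u l r) (internal_subtrees l \<union> internal_subtrees r)"

abbreviation is_internal :: "btree \<Rightarrow> bool" where
  "is_internal v \<equiv> \<not> is_Leaf v"

definition normalized :: "btree \<Rightarrow> bool" where
  "normalized t \<longleftrightarrow> (\<forall>v\<in>internal_subtrees t. valency v = valency (left v))"

definition lyndon_vertex :: "btree \<Rightarrow> bool" where
  "lyndon_vertex v \<longleftrightarrow> is_Leaf (left v) \<or> valency (right (left v)) > valency (right v)"

definition pointed_lyndon_tree :: "btree \<Rightarrow> bool" where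
  "pointed_lyndon_tree t \<longleftrightarrow> distinct (leaves t) \<and> normalized t \<and>
     (\<forall>v\<in>internal_subtrees t. is_internal (left v) \<longrightarrow>
        color (left v) \<ge> color v \<and> (color (left v) = True \<and> color v = True \<longrightarrow> lyndon_vertex v))"

text \<open>
  Each slide moves the new vertex \<open>r\<close> one step down the leftmost path, so after \<open>k\<close> slides
  it is the vertex at depth \<open>k\<close> on that path.  \<open>slide_at k t\<close> slides this vertex past
  its left child.
\<close>

fun slide_at :: "nat \<Rightarrow> btree \<Rightarrow> btree" where
  "slide_at 0 (Node u (Node c xl xr) y) = Node c (Node u xl y) xr"
| "slide_at (Suc k) (Node c l r) = Node c (slide_at k l) r"
| "slide_at _ t = t"

definition tree_merge :: "bool \<Rightarrow> btree \<Rightarrow> btree \<Rightarrow> btree" where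
  "tree_merge u t1 t2 =
     snd (while (\<lambda>(k, t). \<not> pointed_lyndon_tree t) (\<lambda>(k, t). (Suc k, slide_at k t))
       (0, Node u t1 t2))"

text \<open>A forest is the set of its components.\<close>

definition pointed_lyndon_forests :: "nat \<Rightarrow> btree set set" where
  "pointed_lyndon_forests n =
     {F. (\<forall>t\<in>F. pointed_lyndon_tree t) \<and> inj_on (\<lambda>t. set (leaves t)) F \<and>
         partition_on {1..n} ((\<lambda>t. set (leaves t)) ` F)}"

definition FLyn :: "nat \<Rightarrow> btree set rel" where
  "FLyn n = poset_gen (pointed_lyndon_forests n)
     (\<lambda>F F'. \<exists>t1\<in>F. \<exists>t2\<in>F. \<exists>u. valency t1 < valency t2 \<and>
        F' = insert (tree_merge u t1 t2) (F - {t1, t2}))"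

end

theory Submission
  imports Defs
begin

text \<open>
  Both posets are the reachability orders of deterministic transition systems whose steps
  carry labels \<open>(a, b, u)\<close>, and in both a word of labels can be read from the bottom iff each
  letter merges two numbers that are still block minima; so the same words occur in both.  Two
  consecutive letters that form an ascent can be exchanged without changing the end state, and
  since the label order is a weak order, sorting a word is stable sorting.

  In the pointed partitions every interval has a unique chain with increasing word, and in the
  forests every interval has a unique chain with ascent-free word, because trace monoids are
  cancellative.  A sign-reversing involution shows that if every interval has a unique
  chain whose word satisfies \<open>R\<close> at consecutive letters, then the Moebius function counts, up to
  sign, the words that violate \<open>R\<close> at all consecutive letters.  Taking the order of labels for
  \<open>R\<close> in one case and its negation in the other exchanges the two kinds of Whitney numbers.
  Along an ascent-free word no slide takes place, so forests and ascent-free words determine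
  each other, which gives the isomorphism.
\<close>

section \<open>Sorting label words\<close>

text \<open>Reading an ascent-free word off the trees works only for paths from the leaf forest: a
  general interval starts at trees whose vertices may already cause slides. Cancellation closes this
  gap. It rests on the classes of mutually incomparable labels, which are the sets of all
  \<open>(a, b, False)\<close> with fixed \<open>a\<close> and the singletons of the chains. An
  exchange of an ascent never involves two letters of one class, so sorting preserves the subword on
  each class, and an ascent-free word is determined by these subwords. The slides obey the same
  comparison of labels. On the leftmost path of a pointed Lyndon tree all merge labels share their
  first entry, and from the deepest vertex up to the root they form an ascent-free word. Sliding a
  new root down inserts one more letter into this sorted word, which is why forests allow the same
  exchanges as partitions.\<close>

lemma label_less_irrefl [simp]: "\<not> label_less x x"
  by (cases x) auto

lemma label_less_trans: "label_less x y \<Longrightarrow> label_less y z \<Longrightarrow> label_less x z"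
  by (cases x; cases y; cases z) auto

text \<open>Labels are compared lexicographically by \<open>a\<close>, then \<open>u\<close>, then
  \<open>b\<close>, where \<open>b\<close> counts only if \<open>u\<close> holds. These keys are
  linearly ordered, so the negated order is a total preorder.\<close>

lemma not_label_less_trans:
  "\<not> label_less x y \<Longrightarrow> \<not> label_less y z \<Longrightarrow> \<not> label_less x z"
  by (cases x; cases y; cases z) auto

lemma ascent_free_iff_successively: "ascent_free lt w \<longleftrightarrow> successively (\<lambda>x y. \<not> lt x y) w"
  by (simp add: ascent_free_def successively_conv_nth)

lemma ascent_free_iff_sorted_wrt:
  "ascent_free label_less w \<longleftrightarrow> sorted_wrt (\<lambda>x y. \<not> label_less x y) w"
  unfolding ascent_free_iff_successively
  by (rule successively_conv_sorted_wrt) (auto intro!: transpI dest: not_label_less_trans)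

text \<open>Pairs at any distance are counted, as for inversions: an exchange lowers this number by
  exactly one, whereas the number of adjacent ascents can grow.\<close>

fun ascents :: "label list \<Rightarrow> nat" where
  "ascents [] = 0"
| "ascents (x # w) = length (filter (label_less x) w) + ascents w"

lemma ascents_swap:
  "label_less x y \<Longrightarrow> ascents (p @ x # y # q) = Suc (ascents (p @ y # x # q))"
  by (induction p) (auto dest: label_less_trans)

lemma swap_first_ascent_eq:
  assumes "\<not> ascent_free lt w"
  obtains p x y q where "w = p @ x # y # q" "lt x y" "swap_first_ascent lt w = p @ y # x # q"
proof -
  define i where "i = (LEAST i. Suc i < length w \<and> lt (w ! i) (w ! Suc i))"
  have i: "Suc i < length w \<and> lt (w ! i) (w ! Suc i)"
    unfolding i_def by (rule LeastI_ex) (use assms in \<open>auto simp: ascent_free_def\<close>)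
  define p x y q where "p = take i w" and "x = w ! i" and "y = w ! Suc i" and "q =
      drop (Suc (Suc i)) w"
  have w: "w = p @ x # y # q"
    using i by (simp add: p_def x_def y_def q_def Cons_nth_drop_Suc)
  have "length p = i" using i by (simp add: p_def)
  then have "w[i := y, Suc i := x] = p @ y # x # q"
    by (subst w) (simp add: list_update_append)
  then have "swap_first_ascent lt w = p @ y # x # q"
    by (simp add: swap_first_ascent_def x_def y_def flip: i_def)
  with w i show thesis by (intro that[of p x y q]) (auto simp: x_def y_def)
qed

text \<open>This is the access to the sorting loop: it terminates because \<open>ascents\<close>
  drops, and whatever survives every exchange of an adjacent ascent holds at the end. That the
  leftmost ascent is chosen does not matter.\<close>

lemma sort_word_invariant:
  assumes "P w" and "\<And>p x y q. P (p @ x # y # q) \<Longrightarrow> label_less x y \<Longrightarrow> P (p @ y # x # q)"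
  shows "P (sort_word label_less w) \<and> ascent_free label_less (sort_word label_less w)"
  unfolding sort_word_def
proof (rule while_rule[where P = P and r = "measure ascents"])
  show "P w" by fact
next
  fix s assume "P s" "\<not> ascent_free label_less s"
  then show "P (swap_first_ascent label_less s)"
    by (metis swap_first_ascent_eq assms(2))
next
  fix s assume "P s" "\<not> ascent_free label_less s"
  then obtain p x y q where "s = p @ x # y # q" "label_less x y"
      "swap_first_ascent label_less s = p @ y # x # q"
    by (metis swap_first_ascent_eq)
  then show "(swap_first_ascent label_less s, s) \<in> measure ascents"
    by (simp add: ascents_swap)
qed auto

lemma ascent_free_sort_word: "ascent_free label_less (sort_word label_less w)"
  using sort_word_invariant[of "\<lambda>_. True"] by blast

definition incomparable :: "label \<Rightarrow> label \<Rightarrow> bool" where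
  "incomparable x y \<longleftrightarrow> \<not> label_less x y \<and> \<not> label_less y x"

text \<open>Stability: exchanged letters are comparable, and by negative transitivity no
  \<open>z\<close> is incomparable to both of them.\<close>

lemma filter_sort_word:
  "filter (incomparable z) (sort_word label_less w) = filter (incomparable z) w"
proof -
  have "\<not> (incomparable z x \<and> incomparable z y)" if "label_less x y" for x y
    using that not_label_less_trans[of x z y] by (auto simp: incomparable_def)
  then show ?thesis
    by (intro sort_word_invariant[of "\<lambda>v. filter (incomparable z) v =
        filter (incomparable z) w" w, THEN conjunct1])
      auto
qed

text \<open>The head of an ascent-free word is not below any of its letters. As each head occurs in
  the other word, the two heads are incomparable; both then lead the subword on the same class and
  are equal.\<close>

lemma ascent_free_eqI:
  assumes "ascent_free label_less w" "ascent_free label_less v"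
    and "\<And>z. filter (incomparable z) w = filter (incomparable z) v"
  shows "w = v"
  using assms
proof (induction w arbitrary: v)
  case Nil
  then show ?case
    using Nil.prems(3)[of "hd v"] by (cases v) (auto simp: incomparable_def simp del: label_less.simps)
next
  case (Cons x w)
  have refl: "incomparable z z" for z by (simp add: incomparable_def)
  have "x \<in> set v" using arg_cong[OF Cons.prems(3)[of x], of set] refl by auto
  then obtain y v' where v: "v = y # v'" by (cases v) auto
  have "y \<in> set (x # w)" using arg_cong[OF Cons.prems(3)[of y], of set] refl[of y] v
      by (auto split: if_splits)
  then have xy: "incomparable x y"
    using Cons.prems(1,2) \<open>x \<in> set v\<close> unfolding v ascent_free_iff_sorted_wrt incomparable_def
        by auto
  then have "x = y" using Cons.prems(3)[of x] refl v by simp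
  moreover have "w = v'"
  proof (rule Cons.IH)
    show "ascent_free label_less w" "ascent_free label_less v'"
      using Cons.prems(1,2) v by (simp_all add: ascent_free_iff_sorted_wrt)
    show "filter (incomparable z) w = filter (incomparable z) v'" for z
      using Cons.prems(3)[of z] v \<open>x = y\<close> by (auto split: if_splits)
  qed
  ultimately show ?case using v by simp
qed

text \<open>On each class the subword of a concatenation is the concatenation of the subwords, so
  the common prefix drops out.\<close>

lemma sort_word_eq_cancel:
  assumes "sort_word label_less (w @ d) = sort_word label_less (w @ e)"
    and "ascent_free label_less d" "ascent_free label_less e"
  shows "d = e"
proof (rule ascent_free_eqI[OF assms(2,3)])
  fix z
  have "filter (incomparable z) (w @ d) = filter (incomparable z) (w @ e)"
    by (metis assms(1) filter_sort_word)
  then show "filter (incomparable z) d = filter (incomparable z) e" by simp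
qed

section \<open>Label words of merge systems\<close>

fun merge_word :: "nat set \<Rightarrow> label list \<Rightarrow> bool" where
  "merge_word M [] \<longleftrightarrow> True"
| "merge_word M ((a, b, u) # w) \<longleftrightarrow> a < b \<and> a \<in> M \<and> b \<in> M \<and> merge_word (M - {b}) w"

lemma merge_word_bounds:
  "merge_word M w \<Longrightarrow> finite M \<Longrightarrow> length w \<le> card M \<and> set w \<subseteq> M \<times> M \<times> UNIV"
proof (induction M w rule: merge_word.induct)
  case (2 M a b u w)
  then have "length w \<le> card (M - {b}) \<and> set w \<subseteq> (M - {b}) \<times> (M - {b}) \<times> UNIV" by simp
  moreover have "card M > 0" using 2 by (auto simp: card_gt_0_iff)
  ultimately show ?case using 2 by (auto simp: card_Diff_singleton)
qed simp

lemma finite_merge_words: "finite M \<Longrightarrow> finite {w. merge_word M w}"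
  by (rule finite_subset[OF _ finite_lists_length_le[of "M \<times> M \<times> UNIV" "card M"]])
     (auto dest: merge_word_bounds)

text \<open>
  A sign-reversing involution on words cut into an \<open>R\<close>-descending and an \<open>R\<close>-increasing
  part.
\<close>

definition move_cut :: "('l \<Rightarrow> 'l \<Rightarrow> bool) \<Rightarrow> 'l list \<times> 'l list \<Rightarrow> 'l list \<times> 'l list" where
  "move_cut R = (\<lambda>(v, w).
     if v \<noteq> [] \<and> (w = [] \<or> R (last v) (hd w)) then (butlast v, last v # w)
     else (v @ [hd w], tl w))"

text \<open>The empty word is excluded because its only cut has no letter that could be
  moved.\<close>

definition cuts :: "('l \<Rightarrow> 'l \<Rightarrow> bool) \<Rightarrow> ('l list \<times> 'l list) set" where
  "cuts R = {(v, w). v @ w \<noteq> [] \<and> successively (\<lambda>x y. \<not> R x y) v \<and> successively R w}"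

text \<open>If both parts are nonempty, the letters at the cut are related by \<open>R\<close> or
  not, so exactly one of them can change sides. After the move the opposite case holds at the new
  cut, and the same letter moves back.\<close>

lemma move_cut:
  assumes "c \<in> cuts R"
  shows "move_cut R c \<in> cuts R" "move_cut R (move_cut R c) = c"
    and "fst (move_cut R c) @ snd (move_cut R c) = fst c @ snd c"
    and "(- 1 :: int) ^ length (fst (move_cut R c)) = - ((- 1) ^ length (fst c))"
proof -
  obtain v w where c: "c = (v, w)" by (cases c)
  have vw: "v @ w \<noteq> []" "successively (\<lambda>x y. \<not> R x y) v" "successively R w"
    using assms by (auto simp: c cuts_def)
  consider (left) v' x where "v = v' @ [x]" and "w = [] \<or> R x (hd w)"
    | (right) x w' where "w = x # w'" and "v = [] \<or> \<not> R (last v) x"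
    using vw(1) by (cases v rule: rev_cases; cases w) auto
  then have "move_cut R c \<in> cuts R \<and> move_cut R (move_cut R c) = c
    \<and> fst (move_cut R c) @ snd (move_cut R c) = fst c @ snd c
    \<and> (- 1 :: int) ^ length (fst (move_cut R c)) = - ((- 1) ^ length (fst c))"
  proof cases
    case left
    then show ?thesis using vw
      by (cases w; cases v' rule: rev_cases) (auto simp: c move_cut_def cuts_def successively_append_iff butlast_append)
  next
    case right
    then show ?thesis using vw
      by (cases w') (auto simp: c move_cut_def cuts_def successively_append_iff butlast_append)
  qed
  then show "move_cut R c \<in> cuts R" "move_cut R (move_cut R c) = c"
    "fst (move_cut R c) @ snd (move_cut R c) = fst c @ snd c"
    "(- 1 :: int) ^ length (fst (move_cut R c)) = - ((- 1) ^ length (fst c))" by auto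
qed

text \<open>\<open>T\<close> is closed under recutting a word, so \<open>move_cut\<close> maps it to
  itself and the sum equals its own negative.\<close>

lemma alternating_sum_cuts:
  assumes "T \<subseteq> cuts R" and "\<And>v w v' w'. (v, w) \<in> T \<Longrightarrow> (v', w') \<in> cuts R \<Longrightarrow> v' @ w' = v @ w \<Longrightarrow>
      (v', w') \<in> T"
  shows "(\<Sum>c\<in>T. (- 1) ^ length (fst c)) = (0 :: int)"
proof -
  have in_T: "move_cut R c \<in> T" if "c \<in> T" for c
    using that assms(1) assms(2)[of "fst c" "snd c" "fst (move_cut R c)"
        "snd (move_cut R c)"] move_cut[of c R]
    by auto
  have "(\<Sum>c\<in>T. (- 1 :: int) ^ length (fst c)) = (\<Sum>c\<in>T. - ((- 1) ^ length (fst c)))"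
    by (rule sum.reindex_bij_witness[of _ "move_cut R" "move_cut R"])
      (use in_T move_cut(2,4)[OF subsetD[OF assms(1)]] in simp_all)
  then show ?thesis by (simp add: sum_negf)
qed

text \<open>\<open>step_iff\<close> and \<open>step_mins\<close> make the readable words depend on
  the minima alone; \<open>step_label\<close> makes the edge labeling well defined.
  \<open>step_swap\<close> is demanded for ascents only: in a descent the second letter may absorb
  the block that the first one has enlarged, and then the order of the merges cannot be
  reversed.\<close>

locale merge_system =
  fixes n :: nat and S :: "'s set" and step :: "'s \<Rightarrow> label \<Rightarrow> 's \<Rightarrow> bool"
    and mins :: "'s \<Rightarrow> nat set" and s0 :: 's
  assumes s0: "s0 \<in> S" "mins s0 = {1..n}"
    and step_closed: "s \<in> S \<Longrightarrow> step s l t \<Longrightarrow> t \<in> S"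
    and step_iff: "s \<in> S \<Longrightarrow> (\<exists>t. step s (a, b, u) t) \<longleftrightarrow> a < b \<and> a \<in> mins s \<and> b \<in> mins s"
    and step_mins: "s \<in> S \<Longrightarrow> step s (a, b, u) t \<Longrightarrow> mins t = mins s - {b}"
    and step_det: "s \<in> S \<Longrightarrow> step s l t \<Longrightarrow> step s l t' \<Longrightarrow> t = t'"
    and step_label: "s \<in> S \<Longrightarrow> step s l t \<Longrightarrow> step s l' t \<Longrightarrow> l = l'"
    and step_swap: "s \<in> S \<Longrightarrow> step s l s' \<Longrightarrow> step s' l' t \<Longrightarrow> label_less l l' \<Longrightarrow>
      \<exists>s''. step s l' s'' \<and> step s'' l t"
begin

fun path :: "'s \<Rightarrow> label list \<Rightarrow> 's \<Rightarrow> bool" where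
  "path s [] t \<longleftrightarrow> s = t"
| "path s (l # w) t \<longleftrightarrow> (\<exists>s'. step s l s' \<and> path s' w t)"

lemma path_append: "path s (v @ w) t \<longleftrightarrow> (\<exists>s'. path s v s' \<and> path s' w t)"
  by (induction v arbitrary: s) auto

lemma path_closed: "path s w t \<Longrightarrow> s \<in> S \<Longrightarrow> t \<in> S"
  by (induction w arbitrary: s) (auto dest: step_closed)

lemma path_det: "path s w t \<Longrightarrow> path s w t' \<Longrightarrow> s \<in> S \<Longrightarrow> t = t'"
  by (induction w arbitrary: s) (auto dest: step_closed step_det)

lemma path_iff_merge_word: "s \<in> S \<Longrightarrow> (\<exists>t. path s w t) \<longleftrightarrow> merge_word (mins s) w"
proof (induction w arbitrary: s)
  case (Cons l w)
  obtain a b u where l: "l = (a, b, u)" by (cases l)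
  have "(\<exists>t. path s (l # w) t) \<longleftrightarrow> (\<exists>s'. step s l s' \<and> merge_word (mins s') w)"
    using Cons.IH[OF step_closed[OF Cons.prems]] by (simp only: path.simps) metis
  also have "\<dots> \<longleftrightarrow> merge_word (mins s) (l # w)"
    using step_iff[OF Cons.prems, of a b u] step_mins[OF Cons.prems, of a b u]
    unfolding l merge_word.simps by metis
  finally show ?case .
qed auto

lemma path_mins: "path s w t \<Longrightarrow> s \<in> S \<Longrightarrow> mins t = mins s - (fst \<circ> snd) ` set w"
proof (induction w arbitrary: s)
  case (Cons l w)
  then obtain s' where s': "step s l s'" "path s' w t" by auto
  obtain a b u where l: "l = (a, b, u)" by (cases l)
  show ?case using Cons.IH[OF s'(2)] s' Cons.prems(2) step_closed step_mins[of s a b u s']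
      by (auto simp: l)
qed simp

lemma path_sort_word:
  assumes "s \<in> S" "path s w t"
  shows "path s (sort_word label_less w) t"
proof (rule sort_word_invariant[THEN conjunct1])
  fix p x y q assume "path s (p @ x # y # q) t" "label_less x y"
  moreover from this obtain s1 s2 s3 where s1: "path s p s1" and "step s1 x s2" "step s2 y s3"
      "path s3 q t"
    by (auto simp: path_append)
  moreover have "s1 \<in> S" using path_closed s1 assms(1) .
  ultimately obtain s2' where "step s1 y s2'" "step s2' x s3" using step_swap by blast
  with s1 \<open>path s3 q t\<close> show "path s (p @ y # x # q) t" by (auto simp: path_append)
qed fact

end

text \<open>Reachability is a separate assumption because its proofs for both systems already speak
  of \<open>path\<close>.\<close>

locale reachable_merge_system = merge_system +
  assumes reachable: "t \<in> S \<Longrightarrow> \<exists>w. path s0 w t"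
begin

definition "le = poset_gen S (\<lambda>s t. \<exists>l. step s l t)"

lemma Field_le [simp]: "Field le = S"
  by (simp add: le_def)

lemma le_iff_path: "(s, t) \<in> le \<longleftrightarrow> s \<in> S \<and> (\<exists>w. path s w t)"
proof -
  have "(s, t) \<in> {(s, t). s \<in> S \<and> t \<in> S \<and> (\<exists>l. step s l t)}\<^sup>* \<longleftrightarrow> (\<exists>w. path s w t)" if "s \<in> S" for s
  proof
    assume "(s, t) \<in> {(s, t). s \<in> S \<and> t \<in> S \<and> (\<exists>l. step s l t)}\<^sup>*"
    then show "\<exists>w. path s w t"
    proof induction
      case base
      show ?case by (rule exI[of _ "[]"]) simp
    next
      case (step t t')
      then obtain w l where "path s w t" "step t l t'" by auto
      then show ?case by (intro exI[of _ "w @ [l]"]) (auto simp: path_append)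
    qed
  next
    assume "\<exists>w. path s w t"
    then obtain w where "path s w t" ..
    then show "(s, t) \<in> {(s, t). s \<in> S \<and> t \<in> S \<and> (\<exists>l. step s l t)}\<^sup>*"
      using that
    proof (induction w arbitrary: s)
      case (Cons l w)
      then obtain s' where "step s l s'" "path s' w t" by auto
      moreover have "s' \<in> S" using Cons.prems calculation step_closed by blast
      ultimately have "(s, s') \<in> {(s, t). s \<in> S \<and> t \<in> S \<and> (\<exists>l. step s l t)}"
        "(s', t) \<in> {(s, t). s \<in> S \<and> t \<in> S \<and> (\<exists>l. step s l t)}\<^sup>*"
        using Cons.IH Cons.prems by blast+
      then show ?case by (rule converse_rtrancl_into_rtrancl)
    qed simp
  qed
  then show ?thesis using path_closed by (auto simp: le_def poset_gen_def)
qed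

definition rk :: "'a \<Rightarrow> nat" where "rk s = n - card (mins s)"

lemma mins_subset: "s \<in> S \<Longrightarrow> mins s \<subseteq> {1..n}"
  using reachable path_mins s0 by fastforce

lemma rk_s0 [simp]: "rk s0 = 0"
  by (simp add: rk_def s0)

lemma rk_step:
  assumes "s \<in> S" "step s l t"
  shows "rk t = Suc (rk s)"
proof -
  obtain a b u where l: "l = (a, b, u)" by (cases l)
  have "b \<in> mins s" using assms step_iff[of s a b u] by (auto simp: l)
  moreover have "mins t = mins s - {b}" using assms step_mins by (auto simp: l)
  moreover have "finite (mins s)" "card (mins s) \<le> n"
    using mins_subset[OF assms(1)] card_mono[of "{1..n}" "mins s"] by (auto intro: finite_subset)
  moreover from this have "card (mins s) > 0" using \<open>b \<in> mins s\<close> by (auto simp: card_gt_0_iff)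
  ultimately show ?thesis by (simp add: rk_def card_Diff_singleton)
qed

lemma rk_path: "path s w t \<Longrightarrow> s \<in> S \<Longrightarrow> rk t = rk s + length w"
proof (induction w arbitrary: s)
  case (Cons l w)
  then obtain s' where "step s l s'" "path s' w t" by auto
  then show ?case using Cons.IH[of s'] Cons.prems(2) rk_step step_closed by auto
qed simp

lemma finite_S: "finite S"
proof -
  have "S \<subseteq> (\<lambda>w. THE t. path s0 w t) ` {w. merge_word {1..n} w}"
  proof
    fix t assume "t \<in> S"
    then obtain w where w: "path s0 w t" using reachable by auto
    then have "(THE t. path s0 w t) = t" using path_det s0(1) by auto
    moreover have "merge_word {1..n} w" using path_iff_merge_word[OF s0(1)] s0(2) w by auto
    ultimately show "t \<in> (\<lambda>w. THE t. path s0 w t) ` {w. merge_word {1..n} w}" by force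
  qed
  then show ?thesis by (rule finite_subset) (simp add: finite_merge_words)
qed

lemma Partial_order_le: "Partial_order le"
proof -
  have "(s, s) \<in> le" if "s \<in> S" for s
    using that by (auto simp: le_iff_path intro: exI[of _ "[]"])
  moreover have "le \<subseteq> S \<times> S" using path_closed by (auto simp: le_iff_path)
  moreover have "trans le"
    unfolding trans_def le_iff_path by (metis path_append)
  moreover have "antisym le"
  proof (rule antisymI)
    fix s t assume "(s, t) \<in> le" "(t, s) \<in> le"
    then obtain v w where "s \<in> S" "t \<in> S" "path s v t" "path t w s" by (auto simp: le_iff_path)
    then have "length v = 0" using rk_path[of s v t] rk_path[of t w s] by simp
    then show "s = t" using \<open>path s v t\<close> by simp
  qed
  ultimately show ?thesis
    by (auto simp: partial_order_on_def preorder_on_def refl_on_def)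
qed

text \<open>A step raises \<open>rk\<close> by one, so nothing fits strictly in between. Conversely,
  the first step of a path between the ends of a cover already arrives at the upper end.\<close>

lemma covers_le_iff: "covers le s t \<longleftrightarrow> s \<in> S \<and> (\<exists>l. step s l t)"
proof
  assume c: "covers le s t"
  then obtain w where w: "s \<in> S" "path s w t" "s \<noteq> t" by (auto simp: covers_def le_iff_path)
  then obtain l v s' where l: "w = l # v" "step s l s'" "path s' v t" by (cases w) auto
  moreover from this have "(s, s') \<in> le" using w by (auto simp: le_iff_path intro!: exI[of _ "[l]"])
  moreover have "(s', t) \<in> le" using calculation w step_closed by (auto simp: le_iff_path)
  ultimately have "s' = s \<or> s' = t" using c by (auto simp: covers_def)
  moreover have "s' \<noteq> s" using l(2) rk_step w(1) by fastforce
  ultimately show "s \<in> S \<and> (\<exists>l. step s l t)" using w l(2) by blast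
next
  assume "s \<in> S \<and> (\<exists>l. step s l t)"
  then obtain l where s: "s \<in> S" "step s l t" by auto
  then have rk: "rk t = Suc (rk s)" by (rule rk_step)
  have "z = s \<or> z = t" if sz: "(s, z) \<in> le" and zt: "(z, t) \<in> le" for z
  proof -
    obtain v w where p: "path s v z" "path z w t" "z \<in> S" using sz zt by (auto simp: le_iff_path)
    then have "length v + length w = 1" using rk rk_path s(1) by fastforce
    then have "v = [] \<or> w = []" by (cases v; cases w) auto
    then show ?thesis using p by auto
  qed
  moreover have "(s, t) \<in> le" using s by (auto simp: le_iff_path intro!: exI[of _ "[l]"])
  moreover have "s \<noteq> t" using rk by auto
  ultimately show "covers le s t" by (auto simp: covers_def)
qed

lemma is_bottom_le_iff: "is_bottom le z \<longleftrightarrow> z = s0"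
proof
  have bot: "is_bottom le s0" using s0 reachable by (auto simp: is_bottom_def le_iff_path)
  assume "is_bottom le z"
  then show "z = s0" using bot Partial_order_le
    by (auto simp: is_bottom_def partial_order_on_def dest: antisymD)
qed (use s0 reachable in \<open>auto simp: is_bottom_def le_iff_path\<close>)

definition "lam s t = (THE l. step s l t)"

lemma lam_eq: "s \<in> S \<Longrightarrow> step s l t \<Longrightarrow> lam s t = l"
  unfolding lam_def using step_label by blast

lemma saturated_chain_imp_path:
  "saturated_chain le s t c \<Longrightarrow> path s (label_word lam c) t \<and> length c =
      Suc (length (label_word lam c))"
proof (induction c arbitrary: s)
  case (Cons x c)
  show ?case
  proof (cases c)
    case Nil
    then show ?thesis using Cons.prems by (auto simp: saturated_chain_def label_word_def)
  next
    case (Cons y d)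
    have *: "s = x" "x \<in> S" "covers le x y" "saturated_chain le y t c"
      using Cons.prems by (auto simp: saturated_chain_def Cons)
    then obtain l where "step x l y" by (auto simp: covers_le_iff)
    then show ?thesis using Cons.IH[OF *(4)] * lam_eq
      by (auto simp: Cons label_word_def)
  qed
qed (simp add: saturated_chain_def)

lemma path_imp_saturated_chain:
  "path s w t \<Longrightarrow> s \<in> S \<Longrightarrow> \<exists>c. saturated_chain le s t c \<and> label_word lam c = w"
proof (induction w arbitrary: s)
  case Nil
  then show ?case by (intro exI[of _ "[s]"]) (auto simp: saturated_chain_def label_word_def)
next
  case (Cons l w)
  then obtain s' where s': "step s l s'" "path s' w t" by auto
  then obtain c where c: "saturated_chain le s' t c" "label_word lam c = w"
    using Cons step_closed by blast
  then obtain d where d: "c = s' # d" by (cases c) (auto simp: saturated_chain_def)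
  have "covers le s s'" using s' Cons.prems covers_le_iff by blast
  then show ?case
    by (intro exI[of _ "s # c"])
      (use c d s' Cons.prems lam_eq in \<open>auto simp: saturated_chain_def label_word_def\<close>)
qed

lemma saturated_chain_length:
  assumes "saturated_chain le s t c"
  shows "rk t + 1 = rk s + length c"
proof -
  have "s \<in> S" using assms by (auto simp: saturated_chain_def)
  then show ?thesis using saturated_chain_imp_path[OF assms] rk_path by fastforce
qed

lemma graded_poset_le: "graded_poset le"
  unfolding graded_poset_def
  using Partial_order_le finite_S
  by (auto simp: is_bottom_le_iff dest!: saturated_chain_length)

lemma rank_le: "s \<in> S \<Longrightarrow> rank le s = rk s"
proof -
  assume "s \<in> S"
  then obtain w where "path s0 w s" using reachable by auto
  then obtain c where c: "saturated_chain le s0 s c" using path_imp_saturated_chain s0 by blast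
  show ?thesis unfolding rank_def is_bottom_le_iff
    by (rule the_equality) (use c saturated_chain_length in force)+
qed

lemma R_elems_le: "R_elems lt lam le = {(s, w). path s0 w s \<and> ascent_free lt w}"
proof -
  have "(\<exists>c. saturated_chain le s0 s c \<and> w = label_word lam c) \<longleftrightarrow> path s0 w s" for s w
    using saturated_chain_imp_path[of s0 s] path_imp_saturated_chain[OF _ s0(1), of w s] by metis
  then show ?thesis
    unfolding R_elems_def is_bottom_le_iff by auto
qed

text \<open>This is Stanley's theorem on R-labelings, with an arbitrary relation \<open>R\<close> on
  labels in place of the order. Words are counted globally, since each one has a single end
  state.\<close>

lemma whitney_le:
  assumes uniq: "\<And>s t w. s \<in> S \<Longrightarrow> path s w t \<Longrightarrow> \<exists>!v. path s v t \<and> successively R v"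
  shows "whitney_first le k =
      (- 1) ^ k * int (card {w. merge_word {1..n} w \<and> length w = k \<and>
          successively (\<lambda>x y. \<not> R x y) w})" (is ?first)
    and "whitney_second le k =
      card {w. merge_word {1..n} w \<and> length w = k \<and> successively R w}" (is ?second)
proof -
  define D where "D = (\<lambda>t. {w. path s0 w t \<and> successively (\<lambda>x y. \<not> R x y) w})"
  have mw: "merge_word {1..n} w \<longleftrightarrow> (\<exists>t. path s0 w t)" for w
    using path_iff_merge_word[OF s0(1), of w] s0(2) by simp
  have fin: "finite {w. path s0 w t \<and> P w}" for t P
    by (rule finite_subset[OF _ finite_merge_words[of "{1..n}"]]) (auto simp: mw simp del: One_nat_def)
  have len: "length w = rk t" if "path s0 w t" for w t
    using rk_path[OF that] s0 by simp
  \<comment> \<open>With value 1 at the bottom, this vanishing is the recursion that defines the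
    Moebius function; \<open>mob\<close> follows from it by induction on the rank.\<close>
  have zero: "(\<Sum>s | (s, t) \<in> le. (- 1) ^ rk s * int (card (D s))) = 0" if t: "t \<in> S" "t \<noteq> s0" for t
  proof -
    define Z where "Z = {s. (s, t) \<in> le}"
    define T where "T = {(v, w) \<in> cuts R. path s0 (v @ w) t}"
    \<comment> \<open>A word \<open>v\<close> from the bottom to \<open>s\<close> becomes a cut of a
      word that ends in \<open>t\<close>: it is continued by the unique \<open>R\<close>-word from
      \<open>s\<close> to \<open>t\<close>.\<close>
    define g where "g = (\<lambda>s (v :: label list). (v, THE w. path s w t \<and> successively R w))"
    have finZ: "finite Z" by (rule finite_subset[OF _ finite_S]) (auto simp: Z_def le_iff_path)
    have g: "path s (snd (g s v)) t \<and> successively R (snd (g s v))" if "s \<in> Z" for s v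
      using theI'[OF uniq] that unfolding g_def Z_def le_iff_path by fastforce
    have g_unique: "g s v = (v, w)" if "s \<in> Z" "path s w t" "successively R w" for s v w
      using the1_equality[OF uniq, of s w t w] that unfolding g_def Z_def le_iff_path by fastforce
    have "(\<Sum>s\<in>Z. (- 1) ^ rk s * int (card (D s))) = (\<Sum>s\<in>Z. \<Sum>v\<in>D s. (- 1) ^ length v)"
    proof (rule sum.cong[OF refl])
      fix s
      have "(\<Sum>v\<in>D s. (- 1 :: int) ^ length v) = (\<Sum>v\<in>D s. (- 1) ^ rk s)"
        by (rule sum.cong) (auto simp: D_def len)
      then show "(- 1) ^ rk s * int (card (D s)) = (\<Sum>v\<in>D s. (- 1) ^ length v)" by simp
    qed
    also have "\<dots> = (\<Sum>(s, v)\<in>Sigma Z D. (- 1) ^ length v)"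
      by (rule sum.Sigma) (auto simp: finZ D_def fin)
    also have "\<dots> = (\<Sum>c\<in>T. (- 1) ^ length (fst c))"
    proof (rule sum.reindex_bij_witness[of _ "\<lambda>c. (THE s. path s0 (fst c) s, fst c)"
        "\<lambda>(s, v). g s v"])
      fix a assume a: "a \<in> Sigma Z D"
      obtain s v where sv: "a = (s, v)" "s \<in> Z" "path s0 v s" "successively (\<lambda>x y. \<not> R x y) v"
        using a by (cases a) (auto simp: D_def)
      have "path s0 (v @ snd (g s v)) t" using g sv by (auto simp: path_append)
      \<comment> \<open>Here \<open>t \<noteq> s0\<close> is used: it provides the nonempty word
        that \<open>cuts\<close> demands.\<close>
      moreover from this have "v @ snd (g s v) \<noteq> []" using t by (auto simp del: append_is_Nil_conv)
      ultimately show "(case a of (s, v) \<Rightarrow> g s v) \<in> T"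
        using g sv by (auto simp: T_def cuts_def g_def)
      show "(THE s. path s0 (fst (case a of (s, v) \<Rightarrow> g s v)) s, fst (case a of (s, v) \<Rightarrow> g s v)) = a"
        using sv path_det[OF _ _ s0(1)] by (auto simp: g_def)
      show "(- 1) ^ length (fst (case a of (s, v) \<Rightarrow> g s v)) = (case a of (s, v) \<Rightarrow> (- 1) ^ length v)"
        by (auto simp: sv g_def)
    next
      fix c assume c: "c \<in> T"
      obtain v w where vw: "c = (v, w)" "path s0 (v @ w) t" "successively (\<lambda>x y. \<not> R x y) v"
          "successively R w"
        using c by (cases c) (auto simp: T_def cuts_def)
      then obtain s where s: "path s0 v s" "path s w t" by (auto simp: path_append)
      then have "(THE s. path s0 v s) = s" using path_det[OF _ _ s0(1)] by blast
      moreover have "s \<in> Z" using s path_closed s0 by (auto simp: Z_def le_iff_path)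
      moreover have "g s v = c" using g_unique \<open>s \<in> Z\<close> s(2) vw by simp
      moreover have "v \<in> D s" using s(1) vw by (simp add: D_def)
      ultimately show "(case (THE s. path s0 (fst c) s, fst c) of (s, v) \<Rightarrow> g s v) = c"
        "(THE s. path s0 (fst c) s, fst c) \<in> Sigma Z D"
        by (simp_all add: vw(1))
    qed
    also have "\<dots> = 0"
      by (rule alternating_sum_cuts[of _ R]) (auto simp: T_def)
    finally show ?thesis by (simp add: Z_def)
  qed
  have mob: "t \<in> S \<Longrightarrow> mobius le s0 t = (- 1) ^ rk t * int (card (D t))" for t
  proof (induction "rk t" arbitrary: t rule: less_induct)
    case less
    have s0t: "(s0, t) \<in> le" using less.prems reachable s0 by (auto simp: le_iff_path)
    show ?case
    proof (cases "t = s0")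
      case True
      have "w = []" if "path s0 w s0" for w using len[OF that] by simp
      then have "D s0 = {[]}" by (auto simp: D_def)
      then show ?thesis using s0t True Partial_order_le finite_S by (simp add: mobius.simps)
    next
      case False
      have IH: "mobius le s0 s = (- 1) ^ rk s * int (card (D s))" if st: "(s, t) \<in> le" "s \<noteq> t" for s
      proof (rule less.hyps)
        show "s \<in> S" using st by (auto simp: le_iff_path)
        obtain w where w: "path s w t" using st by (auto simp: le_iff_path)
        then have "w \<noteq> []" using st by auto
        then show "rk s < rk t" using rk_path[OF w \<open>s \<in> S\<close>] by simp
      qed
      have tt: "(t, t) \<in> le" using less.prems by (auto simp: le_iff_path intro: exI[of _ "[]"])
      have fin_le: "finite {s. (s, t) \<in> le}"
        by (rule finite_subset[OF _ finite_S]) (auto simp: le_iff_path)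
      have bot: "(s0, s) \<in> le" if "(s, t) \<in> le" for s
        using that reachable s0 by (auto simp: le_iff_path)
      have "mobius le s0 t = - (\<Sum>s | (s0, s) \<in> le \<and> (s, t) \<in> le \<and> s \<noteq> t. mobius le s0 s)"
        using s0t False Partial_order_le finite_S by (subst mobius.simps) auto
      also have "{s. (s0, s) \<in> le \<and> (s, t) \<in> le \<and> s \<noteq> t} = {s. (s, t) \<in> le} - {t}"
        using bot by auto
      also have "(\<Sum>s\<in>{s. (s, t) \<in> le} - {t}. mobius le s0 s)
          = (\<Sum>s\<in>{s. (s, t) \<in> le} - {t}. (- 1) ^ rk s * int (card (D s)))"
        by (rule sum.cong) (auto simp: IH)
      also have "\<dots> = (\<Sum>s | (s, t) \<in> le. (- 1) ^ rk s * int (card (D s))) - (- 1) ^ rk t * int (card (D t))"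
        using fin_le tt by (subst sum_diff1) auto
      also have "- \<dots> = (- 1) ^ rk t * int (card (D t))"
        using zero less.prems False by simp
      finally show ?thesis .
    qed
  qed
  have S_k: "{s \<in> S. rank le s = k} = {s \<in> S. rk s = k}" by (auto simp: rank_le)
  have fin_k: "finite {s \<in> S. rk s = k}" using finite_S by simp
  have "whitney_first le k = (\<Sum>s | s \<in> S \<and> rk s = k. mobius le s0 s)"
    unfolding whitney_first_def is_bottom_le_iff by (simp add: S_k)
  also have "\<dots> = (\<Sum>s | s \<in> S \<and> rk s = k. (- 1) ^ k * int (card (D s)))"
    by (rule sum.cong) (auto simp: mob)
  also have "\<dots> = (- 1) ^ k * int (card (\<Union>s\<in>{s \<in> S. rk s = k}. D s))"
    using fin_k path_det[OF _ _ s0(1)]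
    by (subst card_UN_disjoint) (auto simp: D_def fin sum_distrib_left)
  also have "(\<Union>s\<in>{s \<in> S. rk s = k}. D s)
      = {w. merge_word {1..n} w \<and> length w = k \<and> successively (\<lambda>x y. \<not> R x y) w}"
    using len path_closed[OF _ s0(1)] unfolding D_def mw by auto metis
  finally show ?first .
  \<comment> \<open>Each state is the end of exactly one \<open>R\<close>-word from the bottom, so
    counting states of rank \<open>k\<close> is counting \<open>R\<close>-words of length
    \<open>k\<close>.\<close>
  have "bij_betw (\<lambda>w. THE t. path s0 w t) {w. merge_word {1..n} w \<and> length w = k \<and> successively R w}
      {s \<in> S. rk s = k}"
  proof (rule bij_betwI[where g = "\<lambda>t. THE w. path s0 w t \<and> successively R w"], goal_cases)
    case 1
    have "(THE t. path s0 w t) = t" if "path s0 w t" for w t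
      using that path_det[OF _ _ s0(1)] by blast
    then show ?case using len path_closed[OF _ s0(1)] by (auto simp: mw simp del: One_nat_def)
  next
    case 2
    have "\<exists>!w. path s0 w t \<and> successively R w" if "t \<in> S" for t
      using reachable[OF that] uniq s0(1) by blast
    from theI'[OF this] show ?case using len by (auto simp: mw simp del: One_nat_def)
  next
    case (3 w)
    then obtain t where t: "path s0 w t" "successively R w" by (auto simp: mw simp del: One_nat_def)
    then have "(THE t. path s0 w t) = t" using path_det[OF _ _ s0(1)] by blast
    then show ?case using t uniq[OF s0(1) t(1)] by auto
  next
    case (4 t)
    then have "\<exists>!w. path s0 w t \<and> successively R w"
      using reachable uniq s0(1) by blast
    from theI'[OF this] show ?case using path_det[OF _ _ s0(1)] by blast
  qed
  then show ?second
    unfolding whitney_second_def by (simp add: S_k bij_betw_same_card)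
qed

end

section \<open>Pointed partitions as a merge system\<close>

text \<open>A pointed partition is handled through two maps on \<open>{1..n}\<close>, to the minimum
  and to the point of the block of an element. Merges become updates of these maps, and equalities
  of partitions can be checked pointwise.\<close>

definition blk :: "pointed_partition \<Rightarrow> nat \<Rightarrow> nat set \<times> nat" where
  "blk \<pi> i = (THE X. X \<in> \<pi> \<and> i \<in> fst X)"

definition blk_min :: "pointed_partition \<Rightarrow> nat \<Rightarrow> nat" where
  "blk_min \<pi> i = Min (fst (blk \<pi> i))"

definition blk_pt :: "pointed_partition \<Rightarrow> nat \<Rightarrow> nat" where
  "blk_pt \<pi> i = snd (blk \<pi> i)"

text \<open>Every block contains its point, so blocks are nonempty and two pointed blocks on one set
  share an element. Unique membership therefore covers both injectivity and disjointness.\<close>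

lemma pointed_partitions_iff:
  "\<pi> \<in> pointed_partitions n \<longleftrightarrow>
     (\<forall>(A, p)\<in>\<pi>. p \<in> A \<and> A \<subseteq> {1..n}) \<and> (\<forall>i\<in>{1..n}. \<exists>!X. X \<in> \<pi> \<and> i \<in> fst X)"
  (is "_ \<longleftrightarrow> ?P \<and> ?Q")
proof
  assume \<pi>: "\<pi> \<in> pointed_partitions n"
  then have inj: "inj_on fst \<pi>" and U: "\<Union>(fst ` \<pi>) = {1..n}" and disj: "disjoint (fst ` \<pi>)"
    by (auto simp: pointed_partitions_def partition_on_def)
  have "?P" using \<pi> U by (fastforce simp: pointed_partitions_def)
  moreover have "?Q"
  proof
    fix i assume "i \<in> {1..n}"
    then obtain X where X: "X \<in> \<pi>" "i \<in> fst X" using U by blast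
    moreover have "Y = X" if "Y \<in> \<pi>" "i \<in> fst Y" for Y
    proof -
      have "fst Y = fst X" using disj that X by (auto simp: disjoint_def)
      then show ?thesis using inj that X by (auto dest: inj_onD)
    qed
    ultimately show "\<exists>!X. X \<in> \<pi> \<and> i \<in> fst X" by blast
  qed
  ultimately show "?P \<and> ?Q" ..
next
  assume *: "?P \<and> ?Q"
  have uniq: "X = Y" if "X \<in> \<pi>" "Y \<in> \<pi>" "i \<in> fst X" "i \<in> fst Y" for X Y i
  proof -
    have "case X of (A, p) \<Rightarrow> p \<in> A \<and> A \<subseteq> {1..n}" using bspec[OF conjunct1[OF *] that(1)] .
    then have "i \<in> {1..n}" using that(3) by (cases X) auto
    with * have "\<exists>!X. X \<in> \<pi> \<and> i \<in> fst X" by blast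
    then show ?thesis using that by blast
  qed
  have pt: "snd X \<in> fst X" if "X \<in> \<pi>" for X
    using bspec[OF conjunct1[OF *] that] by (cases X) auto
  have "inj_on fst \<pi>"
    by (rule inj_onI) (metis pt uniq)
  moreover have "disjoint (fst ` \<pi>)"
    using uniq by (auto simp: disjoint_def) (metis fst_conv)+
  moreover have "{} \<notin> fst ` \<pi>" using pt by fastforce
  moreover have "\<Union>(fst ` \<pi>) = {1..n}"
  proof
    show "\<Union>(fst ` \<pi>) \<subseteq> {1..n}" using * by fastforce
    show "{1..n} \<subseteq> \<Union>(fst ` \<pi>)" using * by blast
  qed
  ultimately show "\<pi> \<in> pointed_partitions n"
    using * by (auto simp: pointed_partitions_def partition_on_def)
qed

lemma blk_eq:
  assumes "\<pi> \<in> pointed_partitions n" "(A, p) \<in> \<pi>" "i \<in> A"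
  shows "blk \<pi> i = (A, p)"
proof -
  have *: "(\<forall>(A, p)\<in>\<pi>. p \<in> A \<and> A \<subseteq> {1..n}) \<and> (\<forall>i\<in>{1..n}. \<exists>!X. X \<in> \<pi> \<and> i \<in> fst X)"
    using assms(1) by (simp only: pointed_partitions_iff)
  have "i \<in> {1..n}" using bspec[OF conjunct1[OF *] assms(2)] assms(3) by auto
  with * have "\<exists>!X. X \<in> \<pi> \<and> i \<in> fst X" by blast
  then show ?thesis unfolding blk_def by (rule the1_equality) (use assms in auto)
qed

lemma obtain_blk:
  assumes "\<pi> \<in> pointed_partitions n" "i \<in> {1..n}"
  obtains A p where "(A, p) \<in> \<pi>" "i \<in> A"
  using assms unfolding pointed_partitions_iff by (metis prod.collapse)

lemma blockD:
  assumes "\<pi> \<in> pointed_partitions n" "(A, p) \<in> \<pi>"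
  shows "p \<in> A" "A \<subseteq> {1..n}" "finite A" "Min A \<in> A"
proof -
  have *: "\<forall>(A, p)\<in>\<pi>. p \<in> A \<and> A \<subseteq> {1..n}"
    by (rule conjunct1[OF assms(1)[unfolded pointed_partitions_iff]])
  show "p \<in> A" "A \<subseteq> {1..n}" using bspec[OF * assms(2)] by auto
  then show "finite A" "Min A \<in> A" by (auto intro: finite_subset Min_in)
qed

lemma blk_min_eq: "\<pi> \<in> pointed_partitions n \<Longrightarrow> (A, p) \<in> \<pi> \<Longrightarrow> i \<in> A \<Longrightarrow> blk_min \<pi> i = Min A"
  by (simp add: blk_min_def blk_eq)

lemma blk_pt_eq: "\<pi> \<in> pointed_partitions n \<Longrightarrow> (A, p) \<in> \<pi> \<Longrightarrow> i \<in> A \<Longrightarrow> blk_pt \<pi> i = p"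
  by (simp add: blk_pt_def blk_eq)

lemma blk_props:
  assumes "\<pi> \<in> pointed_partitions n" "i \<in> {1..n}"
  shows "blk_min \<pi> i \<in> {1..n}" "blk_min \<pi> i \<le> i" "blk_min \<pi> (blk_min \<pi> i) = blk_min \<pi> i"
    "blk_pt \<pi> i \<in> {1..n}" "blk_min \<pi> (blk_pt \<pi> i) = blk_min \<pi> i"
    "blk_pt \<pi> (blk_min \<pi> i) = blk_pt \<pi> i"
proof -
  obtain A p where A: "(A, p) \<in> \<pi>" "i \<in> A" using obtain_blk[OF assms] .
  note B = blockD[OF assms(1) A(1)] and M = blk_min_eq[OF assms(1) A(1)] blk_pt_eq[OF assms(1) A(1)]
  show "blk_min \<pi> i \<in> {1..n}" "blk_min \<pi> i \<le> i" "blk_min \<pi> (blk_min \<pi> i) = blk_min \<pi> i"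
    "blk_pt \<pi> i \<in> {1..n}" "blk_min \<pi> (blk_pt \<pi> i) = blk_min \<pi> i"
    "blk_pt \<pi> (blk_min \<pi> i) = blk_pt \<pi> i"
    using A B M by auto
qed

lemma blk_pt_cong:
  assumes "\<pi> \<in> pointed_partitions n" "i \<in> {1..n}" "j \<in> {1..n}" "blk_min \<pi> i = blk_min \<pi> j"
  shows "blk_pt \<pi> i = blk_pt \<pi> j"
  using blk_props(6)[OF assms(1,2)] blk_props(6)[OF assms(1,3)] assms(4) by simp

lemma in_block_iff:
  assumes "\<pi> \<in> pointed_partitions n" "(A, p) \<in> \<pi>" "i \<in> {1..n}"
  shows "i \<in> A \<longleftrightarrow> blk_min \<pi> i = Min A"
proof
  assume "blk_min \<pi> i = Min A"
  moreover obtain B q where B: "(B, q) \<in> \<pi>" "i \<in> B" using obtain_blk[OF assms(1,3)] .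
  ultimately have "Min A = Min B" using blk_min_eq[OF assms(1)] by simp
  then have "(A, p) = (B, q)"
    using blk_eq[OF assms(1)] blockD[OF assms(1)] assms(2) B(1) by metis
  then show "i \<in> A" using B by simp
qed (simp add: blk_min_eq[OF assms(1,2)])

text \<open>The block with minimum \<open>m\<close> is the fibre of \<open>blk_min\<close> over
  \<open>m\<close>, and its point is the value of \<open>blk_pt\<close> at \<open>m\<close>.\<close>

lemma pointed_partition_eqI:
  assumes "\<pi> \<in> pointed_partitions n" "\<rho> \<in> pointed_partitions n"
    and "\<And>i. i \<in> {1..n} \<Longrightarrow> blk_min \<pi> i = blk_min \<rho> i \<and> blk_pt \<pi> i = blk_pt \<rho> i"
  shows "\<pi> = \<rho>"
proof -
  have "\<pi> \<subseteq> \<rho>" if \<pi>: "\<pi> \<in> pointed_partitions n" and \<rho>: "\<rho> \<in> pointed_partitions n"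
    and eq: "\<And>i. i \<in> {1..n} \<Longrightarrow> blk_min \<pi> i = blk_min \<rho> i \<and> blk_pt \<pi> i = blk_pt \<rho> i" for \<pi> \<rho>
  proof (rule subrelI)
    fix A p assume A: "(A, p) \<in> \<pi>"
    note bA = blockD[OF \<pi> A]
    define m where "m = Min A"
    have m: "m \<in> A" "m \<in> {1..n}" using bA by (auto simp: m_def)
    obtain B q where B: "(B, q) \<in> \<rho>" "m \<in> B" using obtain_blk[OF \<rho> m(2)] .
    have "Min B = Min A" using eq[OF m(2)] blk_min_eq[OF \<pi> A m(1)] blk_min_eq[OF \<rho> B] by simp
    then have "i \<in> A \<longleftrightarrow> i \<in> B" if "i \<in> {1..n}" for i
      using in_block_iff[OF \<pi> A that] in_block_iff[OF \<rho> B(1) that] eq[OF that] by simp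
    then have "A = B" using bA(2) blockD(2)[OF \<rho> B(1)] by blast
    moreover have "p = q" using eq[OF m(2)] blk_pt_eq[OF \<pi> A m(1)] blk_pt_eq[OF \<rho> B] by simp
    ultimately show "(A, p) \<in> \<rho>" using B by simp
  qed
  from this[OF assms] this[OF assms(2,1)] assms(3) show ?thesis by force
qed

section \<open>Merges as updates of the two maps\<close>

definition merged_maps :: "nat \<Rightarrow> pointed_partition \<Rightarrow> label \<Rightarrow> pointed_partition \<Rightarrow> bool" where
  "merged_maps n \<pi> l \<rho> \<longleftrightarrow> (case l of (a, b, u) \<Rightarrow> \<forall>i\<in>{1..n}.
     blk_min \<rho> i = (if blk_min \<pi> i = b then a else blk_min \<pi> i) \<and>
     blk_pt \<rho> i = (if blk_min \<pi> i = a \<or> blk_min \<pi> i = b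
       then if u then blk_pt \<pi> a else blk_pt \<pi> b else blk_pt \<pi> i))"

definition pp_mins :: "nat \<Rightarrow> pointed_partition \<Rightarrow> nat set" where
  "pp_mins n \<pi> = {i \<in> {1..n}. blk_min \<pi> i = i}"

lemma pp_mins_iff:
  assumes "\<pi> \<in> pointed_partitions n"
  shows "a \<in> pp_mins n \<pi> \<longleftrightarrow> (\<exists>A p. (A, p) \<in> \<pi> \<and> a = Min A)"
proof
  assume a: "a \<in> pp_mins n \<pi>"
  then have "a \<in> {1..n}" by (simp add: pp_mins_def)
  from obtain_blk[OF assms this] obtain A p where A: "(A, p) \<in> \<pi>" "a \<in> A" .
  moreover from this have "a = Min A" using a blk_min_eq[OF assms A] by (simp add: pp_mins_def)
  ultimately show "\<exists>A p. (A, p) \<in> \<pi> \<and> a = Min A" by blast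
next
  assume "\<exists>A p. (A, p) \<in> \<pi> \<and> a = Min A"
  then obtain A p where A: "(A, p) \<in> \<pi>" "a = Min A" by blast
  have "a \<in> A" "a \<in> {1..n}" using blockD[OF assms A(1)] A(2) by auto
  then show "a \<in> pp_mins n \<pi>" using blk_min_eq[OF assms A(1)] A(2) by (simp add: pp_mins_def)
qed

lemma pp_merge_props:
  assumes \<pi>: "\<pi> \<in> pointed_partitions n" and m: "pp_merge \<pi> (a, b, u) \<rho>"
  shows "a < b" "a \<in> pp_mins n \<pi>" "b \<in> pp_mins n \<pi>" "\<rho> \<in> pointed_partitions n"
    "merged_maps n \<pi> (a, b, u) \<rho>"
proof -
  obtain A p B q where A: "(A, p) \<in> \<pi>" and B: "(B, q) \<in> \<pi>" and ab: "a = Min A" "b = Min B" "a < b"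
    and \<rho>: "\<rho> = insert (A \<union> B, if u then p else q) (\<pi> - {(A, p), (B, q)})"
    using m by (auto simp: pp_merge_def)
  show "a < b" by fact
  show "a \<in> pp_mins n \<pi>" "b \<in> pp_mins n \<pi>" using A B ab by (auto simp: pp_mins_iff[OF \<pi>])
  note bA = blockD[OF \<pi> A] and bB = blockD[OF \<pi> B]
  have uniq: "X = Y" if "X \<in> \<pi>" "Y \<in> \<pi>" "i \<in> fst X" "i \<in> fst Y" for X Y i
    using blk_eq[OF \<pi>, of "fst X" "snd X" i] blk_eq[OF \<pi>, of "fst Y" "snd Y" i] that by simp
  show \<rho>P: "\<rho> \<in> pointed_partitions n"
    unfolding pointed_partitions_iff
  proof
    show "\<forall>(A, p)\<in>\<rho>. p \<in> A \<and> A \<subseteq> {1..n}"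
      unfolding \<rho> using bA(1,2) bB(1,2) blockD(1,2)[OF \<pi>] by (simp del: Un_iff add: UnI1 UnI2) blast
    show "\<forall>i\<in>{1..n}. \<exists>!X. X \<in> \<rho> \<and> i \<in> fst X"
    proof
      fix i assume "i \<in> {1..n}"
      from obtain_blk[OF \<pi> this] obtain C r where C: "(C, r) \<in> \<pi>" "i \<in> C" .
      show "\<exists>!X. X \<in> \<rho> \<and> i \<in> fst X"
      proof (cases "i \<in> A \<union> B")
        case True
        show ?thesis
        proof (rule ex1I[of _ "(A \<union> B, if u then p else q)"])
          fix X assume "X \<in> \<rho> \<and> i \<in> fst X"
          then show "X = (A \<union> B, if u then p else q)"
            using True uniq[of X "(A, p)" i] uniq[of X "(B, q)" i] A B by (auto simp: \<rho>)
        qed (use True in \<open>auto simp: \<rho>\<close>)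
      next
        case False
        show ?thesis
        proof (rule ex1I[of _ "(C, r)"])
          fix X assume "X \<in> \<rho> \<and> i \<in> fst X"
          then show "X = (C, r)" using False C uniq[of X "(C, r)" i] by (auto simp: \<rho>)
        qed (use False C in \<open>auto simp: \<rho>\<close>)
      qed
    qed
  qed
  have "Min (A \<union> B) = a" using ab bA bB by (subst Min_Un) auto
  moreover have mem: "(A \<union> B, if u then p else q) \<in> \<rho>" by (simp add: \<rho>)
  ultimately have new: "blk_min \<rho> i = a" "blk_pt \<rho> i = (if u then p else q)" if "i \<in> A \<union> B" for i
    using blk_min_eq[OF \<rho>P mem that] blk_pt_eq[OF \<rho>P mem that] by simp_all
  have old: "blk_min \<rho> i = blk_min \<pi> i \<and> blk_pt \<rho> i = blk_pt \<pi> i"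
    if i: "i \<in> {1..n}" and "i \<notin> A \<union> B" for i
  proof -
    from obtain_blk[OF \<pi> i] obtain C r where C: "(C, r) \<in> \<pi>" "i \<in> C" .
    then have "(C, r) \<in> \<rho>" using that by (auto simp: \<rho>)
    then show ?thesis
      using C blk_min_eq[OF \<pi> C] blk_pt_eq[OF \<pi> C] blk_min_eq[OF \<rho>P, of C r i] blk_pt_eq[OF \<rho>P, of C r i] by simp
  qed
  have "blk_pt \<pi> a = p" "blk_pt \<pi> b = q"
    using blk_pt_eq[OF \<pi> A] blk_pt_eq[OF \<pi> B] bA bB ab by auto
  then show "merged_maps n \<pi> (a, b, u) \<rho>"
    unfolding merged_maps_def using new old in_block_iff[OF \<pi> A] in_block_iff[OF \<pi> B] ab by auto
qed

text \<open>For minima \<open>a < b\<close> some merge exists, and the prescribed maps leave room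
  for only one result.\<close>

lemma pp_merge_iff:
  assumes "\<pi> \<in> pointed_partitions n"
  shows "pp_merge \<pi> (a, b, u) \<rho> \<longleftrightarrow> a < b \<and> a \<in> pp_mins n \<pi> \<and> b \<in> pp_mins n \<pi> \<and>
    \<rho> \<in> pointed_partitions n \<and> merged_maps n \<pi> (a, b, u) \<rho>"
proof
  assume *: "a < b \<and> a \<in> pp_mins n \<pi> \<and> b \<in> pp_mins n \<pi> \<and>
    \<rho> \<in> pointed_partitions n \<and> merged_maps n \<pi> (a, b, u) \<rho>"
  then obtain \<sigma> where \<sigma>: "pp_merge \<pi> (a, b, u) \<sigma>"
    unfolding pp_mins_iff[OF assms] pp_merge_def by blast
  have "\<rho> = \<sigma>"
    by (rule pointed_partition_eqI[of _ n])
      (use * pp_merge_props(4,5)[OF assms \<sigma>] in \<open>auto simp: merged_maps_def\<close>)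
  with \<sigma> show "pp_merge \<pi> (a, b, u) \<rho>" by simp
qed (simp add: pp_merge_props[OF assms])

lemma ex_pp_merge_iff:
  assumes "\<pi> \<in> pointed_partitions n"
  shows "(\<exists>\<rho>. pp_merge \<pi> (a, b, u) \<rho>) \<longleftrightarrow> a < b \<and> a \<in> pp_mins n \<pi> \<and> b \<in> pp_mins n \<pi>"
  using pp_merge_props[OF assms] unfolding pp_mins_iff[OF assms] pp_merge_def by blast

definition singletons_pp :: "nat \<Rightarrow> pointed_partition" where
  "singletons_pp n = (\<lambda>i. ({i}, i)) ` {1..n}"

lemma singletons_pp: "singletons_pp n \<in> pointed_partitions n"
  "i \<in> {1..n} \<Longrightarrow> blk_min (singletons_pp n) i = i"
  "i \<in> {1..n} \<Longrightarrow> blk_pt (singletons_pp n) i = i"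
proof -
  show S: "singletons_pp n \<in> pointed_partitions n"
    unfolding pointed_partitions_iff by (auto simp: singletons_pp_def)
  show "blk_min (singletons_pp n) i = i" "blk_pt (singletons_pp n) i = i" if "i \<in> {1..n}"
    using blk_min_eq[OF S, of "{i}" i i] blk_pt_eq[OF S, of "{i}" i i] that
    by (auto simp: singletons_pp_def)
qed

interpretation pp: merge_system n "pointed_partitions n" pp_merge "pp_mins n" "singletons_pp n"
    for n
proof
  show "singletons_pp n \<in> pointed_partitions n" by (rule singletons_pp)
  show "pp_mins n (singletons_pp n) = {1..n}" using singletons_pp(2) by (auto simp: pp_mins_def)
  fix s assume s: "s \<in> pointed_partitions n"
  show "t \<in> pointed_partitions n" if "pp_merge s l t" for l t
    using that s by (cases l) (auto simp: pp_merge_iff)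
  show "(\<exists>t. pp_merge s (a, b, u) t) \<longleftrightarrow> a < b \<and> a \<in> pp_mins n s \<and> b \<in> pp_mins n s" for a b u
    by (rule ex_pp_merge_iff[OF s])
  show mins: "pp_mins n t = pp_mins n s - {b}" if "pp_merge s (a, b, u) t" for a b u t
  proof -
    have m: "a < b" "blk_min s a = a" "blk_min s b = b"
      "\<And>i. i \<in> {1..n} \<Longrightarrow> blk_min t i = (if blk_min s i = b then a else blk_min s i)"
      using that by (auto simp: pp_merge_iff[OF s] pp_mins_def merged_maps_def)
    have "blk_min t i = i \<longleftrightarrow> blk_min s i = i \<and> i \<noteq> b" if "i \<in> {1..n}" for i
      using m(1-3) m(4)[OF that] by auto
    then show ?thesis unfolding pp_mins_def by blast
  qed
  show "t = t'" if "pp_merge s l t" "pp_merge s l t'" for l t t'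
  proof (cases l)
    case (fields a b u)
    show ?thesis
      by (rule pointed_partition_eqI[of _ n])
        (use that in \<open>auto simp: fields pp_merge_iff[OF s] merged_maps_def\<close>)
  qed
  \<comment> \<open>The lost minimum gives \<open>b\<close>, the new minimum of its block gives
    \<open>a\<close>, and the new point gives \<open>u\<close>, because the two old points lie in
    different blocks.\<close>
  show "l = l'" if t: "pp_merge s l t" "pp_merge s l' t" for l l' t
  proof -
    obtain a b u where l: "l = (a, b, u)" by (cases l)
    obtain c d v where l': "l' = (c, d, v)" by (cases l')
    have m: "merged_maps n s (a, b, u) t" "merged_maps n s (c, d, v) t"
      "a < b" "c < d" "a \<in> pp_mins n s" "b \<in> pp_mins n s" "c \<in> pp_mins n s" "d \<in> pp_mins n s"
      using t by (auto simp: l l' pp_merge_iff[OF s])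
    have "pp_mins n s - {b} = pp_mins n s - {d}" using mins[of a b u t] mins[of c d v t] t
        by (simp add: l l')
    then have bd: "b = d" using m by blast
    have b: "b \<in> {1..n}" "blk_min s b = b" using m by (auto simp: pp_mins_def)
    have "blk_min t b = a" "blk_min t b = c"
      using m(1,2)[unfolded merged_maps_def prod.case, rule_format, OF b(1)] b(2) bd by auto
    then have ac: "a = c" by simp
    have "blk_min s (blk_pt s a) = a" "blk_min s (blk_pt s b) = b"
      using m blk_props(5)[OF s] by (auto simp: pp_mins_def)
    then have "blk_pt s a \<noteq> blk_pt s b" using m(3) by auto
    moreover have "blk_pt t a = (if u then blk_pt s a else blk_pt s b)"
      "blk_pt t a = (if v then blk_pt s a else blk_pt s b)"
      using m(1,2)[unfolded merged_maps_def prod.case, rule_format, of a] m(5) bd ac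
      by (auto simp: pp_mins_def)
    ultimately have "u = v" by (auto split: if_splits)
    then show ?thesis using ac bd l l' by simp
  qed
  show "\<exists>s''. pp_merge s l' s'' \<and> pp_merge s'' l t"
    if t: "pp_merge s l s'" "pp_merge s' l' t" "label_less l l'" for l l' s' t
  proof -
    obtain a b u where l: "l = (a, b, u)" by (cases l)
    obtain c d v where l': "l' = (c, d, v)" by (cases l')
    have s': "s' \<in> pointed_partitions n" using t s by (auto simp: l pp_merge_iff)
    have m1: "a < b" "a \<in> pp_mins n s" "b \<in> pp_mins n s" "merged_maps n s (a, b, u) s'"
      using t by (auto simp: l pp_merge_iff[OF s])
    have m2: "c < d" "c \<in> pp_mins n s'" "d \<in> pp_mins n s'" "merged_maps n s' (c, d, v) t"
        "t \<in> pointed_partitions n"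
      using t by (auto simp: l' pp_merge_iff[OF s'])
    have ne: "c \<in> pp_mins n s" "d \<in> pp_mins n s" "b \<noteq> c" "b \<noteq> d"
      using m2 mins t(1) by (auto simp: l)
    \<comment> \<open>The ascent enters here: \<open>a \<le> c < d\<close> prevents
      \<open>l'\<close> from absorbing the block of \<open>a\<close>, so \<open>l\<close> is still
      possible after \<open>l'\<close>.\<close>
    have "a \<le> c" using t(3) by (auto simp: l l')
    then have "a \<noteq> d" using m2 by auto
    obtain s'' where s'': "pp_merge s l' s''" using ne m2 ex_pp_merge_iff[OF s, of c d v]
        by (auto simp: l')
    have s''P: "s'' \<in> pointed_partitions n" using s'' s by (auto simp: l' pp_merge_iff)
    have "pp_mins n s'' = pp_mins n s - {d}" using mins s'' by (simp add: l')
    then obtain t' where t': "pp_merge s'' l t'"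
      using m1 ne \<open>a \<noteq> d\<close> ex_pp_merge_iff[OF s''P, of a b u] by (auto simp: l)
    have m3: "merged_maps n s (c, d, v) s''" "merged_maps n s'' (a, b, u) t'"
        "t' \<in> pointed_partitions n"
      using s'' t' by (auto simp: l l' pp_merge_iff[OF s] pp_merge_iff[OF s''P])
    have range: "a \<in> {1..n}" "b \<in> {1..n}" "c \<in> {1..n}" "d \<in> {1..n}"
      and fix_min: "blk_min s a = a" "blk_min s b = b" "blk_min s c = c" "blk_min s d = d"
      using m1 ne by (auto simp: pp_mins_def)
    note maps = m1(4) m2(4) m3(1,2)
    note maps' = maps[unfolded merged_maps_def prod.case, rule_format]
    have "t = t'"
    proof (rule pointed_partition_eqI[of _ n])
      fix i assume i: "i \<in> {1..n}"
      \<comment> \<open>If both merges enlarge the block of \<open>a\<close>, the ascent forces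
        \<open>l'\<close> to be a 1-merge. It keeps the point, so in either order the final point is
        decided by \<open>l\<close> alone.\<close>
      have uv: "a = c \<Longrightarrow> v" using t(3) by (auto simp: l l')
      note facts = maps'[OF i] maps'[OF range(1)] maps'[OF range(2)] maps'[OF range(3)] maps'[OF range(4)]
      show "blk_min t i = blk_min t' i \<and> blk_pt t i = blk_pt t' i"
        using \<open>a \<le> c\<close> \<open>a \<noteq> d\<close> ne(3,4) m1(1) m2(1) uv
        by (simp add: facts fix_min)
    qed fact+
    then show ?thesis using s'' t' by blast
  qed
qed

section \<open>Increasing words of pointed partitions\<close>

lemma label_less_imp_fst_le: "label_less k l \<Longrightarrow> fst k \<le> fst l"
  by (cases k; cases l) auto

context
  fixes n :: nat
begin

text \<open>This is the order of pointed partitions in terms of the maps: blocks of \<open>x\<close>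
  lie inside blocks of \<open>y\<close>, and the point of a block of \<open>y\<close> is already a
  point in \<open>x\<close>.\<close>

definition pp_refines :: "pointed_partition \<Rightarrow> pointed_partition \<Rightarrow> bool" where
  "pp_refines x y \<longleftrightarrow> (\<forall>i\<in>{1..n}. blk_min y (blk_min x i) = blk_min y i \<and> blk_pt x (blk_pt y i) =
      blk_pt y i)"

lemma blk_pt_idem: "x \<in> pointed_partitions n \<Longrightarrow> i \<in> {1..n} \<Longrightarrow> blk_pt x (blk_pt x i) = blk_pt x i"
  by (rule blk_pt_cong) (simp_all only: blk_props)

lemma step_maps:
  assumes "x \<in> pointed_partitions n" "pp_merge x (a, b, u) x'"
  shows "a < b" "a \<in> {1..n}" "b \<in> {1..n}" "blk_min x a = a" "blk_min x b = b"
      "x' \<in> pointed_partitions n"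
    "\<And>i. i \<in> {1..n} \<Longrightarrow> blk_min x' i = (if blk_min x i = b then a else blk_min x i)"
    "\<And>i. i \<in> {1..n} \<Longrightarrow> blk_pt x' i = (if blk_min x i = a \<or> blk_min x i = b
       then if u then blk_pt x a else blk_pt x b else blk_pt x i)"
  using assms(2) unfolding pp_merge_iff[OF assms(1)] by (auto simp: pp_mins_def merged_maps_def)

lemma path_refines: "pp.path x w y \<Longrightarrow> x \<in> pointed_partitions n \<Longrightarrow> pp_refines x y"
proof (induction w arbitrary: x)
  case Nil
  then show ?case using blk_props(3) blk_pt_idem by (simp add: pp_refines_def)
next
  case (Cons l w)
  obtain a b u where l: "l = (a, b, u)" by (cases l)
  obtain x' where x': "pp_merge x (a, b, u) x'" "pp.path x' w y" using Cons.prems by (auto simp: l)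
  note st = step_maps[OF Cons.prems(2) x'(1)]
  have y: "y \<in> pointed_partitions n" using pp.path_closed[OF x'(2) st(6)] .
  have ref: "pp_refines x' y" using Cons.IH[OF x'(2) st(6)] .
  note px = blk_props[OF Cons.prems(2)]
  show ?case unfolding pp_refines_def
  proof (intro ballI conjI)
    fix i assume i: "i \<in> {1..n}"
    have "blk_min x' (blk_min x i) = blk_min x' i"
      using st(7)[OF i] st(7)[OF px(1)[OF i]] px(3)[OF i] by simp
    then show "blk_min y (blk_min x i) = blk_min y i"
      using ref i px(1)[OF i] unfolding pp_refines_def by metis
    \<comment> \<open>Merging creates no new points, so whatever \<open>blk_pt x'\<close> fixes is
      fixed by \<open>blk_pt x\<close>.\<close>
    note fixed = blk_pt_idem[OF Cons.prems(2)]
    have r: "blk_pt y i \<in> {1..n}" using blk_props(4)[OF y i] .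
    have "blk_pt x' (blk_pt y i) = blk_pt y i" using ref i by (simp add: pp_refines_def)
    then show "blk_pt x (blk_pt y i) = blk_pt y i"
      using st(8)[OF r] fixed[OF r] fixed[OF st(2)] fixed[OF st(3)] by (auto split: if_splits)
  qed
qed

text \<open>The last step that changes the minimum above \<open>i\<close> has the final minimum as
  the first entry of its label.\<close>

lemma path_min_changed:
  "pp.path x w y \<Longrightarrow> x \<in> pointed_partitions n \<Longrightarrow> i \<in> {1..n} \<Longrightarrow> blk_min y i \<noteq> blk_min x i \<Longrightarrow>
    \<exists>b u. (blk_min y i, b, u) \<in> set w"
proof (induction w arbitrary: x)
  case (Cons l w)
  obtain a b u where l: "l = (a, b, u)" by (cases l)
  obtain x' where x': "pp_merge x (a, b, u) x'" "pp.path x' w y" using Cons.prems by (auto simp: l)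
  note st = step_maps[OF Cons.prems(2) x'(1)]
  show ?case
  proof (cases "blk_min y i = blk_min x' i")
    case True
    then have "blk_min y i = a" using st(7)[OF Cons.prems(3)] Cons.prems(4)
        by (auto split: if_splits)
    then show ?thesis by (auto simp: l)
  next
    case False
    then show ?thesis using Cons.IH[OF x'(2) st(6) Cons.prems(3)] by auto
  qed
qed simp

lemma min_fixed_downward:
  assumes "y \<in> pointed_partitions n" "pp_refines x y" "x \<in> pointed_partitions n" "c \<in> {1..n}"
      "blk_min y c = c"
  shows "blk_min x c = c"
proof -
  have "blk_min y (blk_min x c) = c" using assms by (auto simp: pp_refines_def)
  then have "c \<le> blk_min x c" using blk_props(1)[OF assms(3,4)] blk_props(2)[OF assms(1)] by metis
  then show ?thesis using blk_props(2)[OF assms(3,4)] by simp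
qed

text \<open>As \<open>c\<close> stays a minimum to the end, its block is touched only by labels that
  start with \<open>c\<close>, and 1-merges among them keep the point.\<close>

lemma path_point_kept:
  "pp.path x w y \<Longrightarrow> x \<in> pointed_partitions n \<Longrightarrow> c \<in> {1..n} \<Longrightarrow> blk_min y c = c \<Longrightarrow>
      (\<And>b. (c, b, False) \<notin> set w) \<Longrightarrow>
    blk_pt y c = blk_pt x c"
proof (induction w arbitrary: x)
  case (Cons l w)
  obtain a b u where l: "l = (a, b, u)" by (cases l)
  obtain x' where x': "pp_merge x (a, b, u) x'" "pp.path x' w y" using Cons.prems by (auto simp: l)
  note st = step_maps[OF Cons.prems(2) x'(1)]
  have y: "y \<in> pointed_partitions n" using pp.path_closed[OF x'(2) st(6)] .
  have "blk_min x' c = c" "blk_min x c = c"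
    using min_fixed_downward[OF y _ _ Cons.prems(3,4)] path_refines Cons.prems(1,2) x'(2) st(6)
        by blast+
  then have "c \<noteq> b" using st(1) st(7)[OF Cons.prems(3)] by auto
  moreover have "c = a \<Longrightarrow> u" using Cons.prems(5)[of b] by (auto simp: l)
  ultimately have "blk_pt x' c = blk_pt x c"
    using st(8)[OF Cons.prems(3)] \<open>blk_min x c = c\<close> by auto
  then show ?case using Cons.IH[OF x'(2) st(6) Cons.prems(3,4)] Cons.prems(5) by simp
qed simp

text \<open>As long as the block of \<open>i\<close> has to join that of \<open>a\<close>, some
  label with first entry \<open>a\<close> is still to come. By monotonicity the current label then
  starts with \<open>a\<close> too, so the block of \<open>i\<close> is absorbed directly, under its
  original minimum.\<close>

lemma increasing_path_labels:
  "pp.path x w y \<Longrightarrow> x \<in> pointed_partitions n \<Longrightarrow> sorted_wrt label_less w \<Longrightarrow> \<forall>l\<in>set w. a \<le> fst l \<Longrightarrow>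
    i \<in> {1..n} \<Longrightarrow> blk_min y i = a \<Longrightarrow> blk_min x i \<noteq> a \<Longrightarrow> \<exists>v. (a, blk_min x i, v) \<in> set w"
proof (induction w arbitrary: x)
  case (Cons l w)
  obtain c e v where l: "l = (c, e, v)" by (cases l)
  obtain x' where x': "pp_merge x (c, e, v) x'" "pp.path x' w y" using Cons.prems by (auto simp: l)
  note st = step_maps[OF Cons.prems(2) x'(1)]
  obtain b u where "(a, b, u) \<in> set (l # w)"
    using path_min_changed[OF Cons.prems(1,2,5)] Cons.prems(6,7) by metis
  then have "c \<le> a" using Cons.prems(3) label_less_imp_fst_le[of l "(a, b, u)"] by (auto simp: l)
  then have "c = a" using Cons.prems(4) by (auto simp: l)
  show ?case
  proof (cases "blk_min x i = e")
    case True
    then show ?thesis by (auto simp: l \<open>c = a\<close>)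
  next
    case False
    then have "blk_min x' i = blk_min x i" using st(7)[OF Cons.prems(5)] by simp
    then show ?thesis using Cons.IH[OF x'(2) st(6)] Cons.prems by auto
  qed
qed simp

text \<open>The first label of an increasing path is determined by the end points of the path.\<close>

lemma increasing_path_first:
  assumes "pp.path x ((a, b, u) # w) y" "x \<in> pointed_partitions n"
      "sorted_wrt label_less ((a, b, u) # w)"
  shows "b \<in> {1..n}" "a < b" "blk_min x b = b" "blk_min y b = a" "blk_min y a = a"
    and "\<And>i. i \<in> {1..n} \<Longrightarrow> blk_min y i \<noteq> blk_min x i \<Longrightarrow> a \<le> blk_min y i"
    and "u \<longleftrightarrow> blk_pt y a = blk_pt x a"
    and "\<not> u \<Longrightarrow> b = blk_min x (blk_pt y a)"
    and "\<And>i. u \<Longrightarrow> i \<in> {1..n} \<Longrightarrow> blk_min y i = a \<Longrightarrow> blk_min x i \<noteq> a \<Longrightarrow> b \<le> blk_min x i"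
proof -
  obtain x' where x': "pp_merge x (a, b, u) x'" "pp.path x' w y" using assms(1) by auto
  note st = step_maps[OF assms(2) x'(1)]
  have y: "y \<in> pointed_partitions n" using pp.path_closed[OF x'(2) st(6)] .
  show "b \<in> {1..n}" "a < b" "blk_min x b = b" by fact+
  have firsts: "\<forall>l\<in>set ((a, b, u) # w). a \<le> fst l"
    using assms(3) label_less_imp_fst_le by fastforce
  show least: "a \<le> blk_min y i" if "i \<in> {1..n}" "blk_min y i \<noteq> blk_min x i" for i
    using path_min_changed[OF assms(1,2) that] firsts by auto
  show ya: "blk_min y a = a"
    using least[OF st(2)] blk_props(2)[OF y st(2)] st(4) by fastforce
  have "blk_min x' b = a" "blk_min x' a = a" using st(1,4,5) st(7)[OF st(3)] st(7)[OF st(2)] by auto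
  then show "blk_min y b = a"
    using path_refines[OF x'(2) st(6)] st(3) ya unfolding pp_refines_def by metis
  have later: "label_less (a, b, u) l" if "l \<in> set w" for l using assms(3) that by simp
  \<comment> \<open>No label above \<open>(a, b, u)\<close> has the form
    \<open>(a, b', False)\<close>, so only the first step can change the point of this
    block.\<close>
  have pt: "blk_pt y a = (if u then blk_pt x a else blk_pt x b)"
  proof -
    have "blk_pt y a = blk_pt x' a"
      using path_point_kept[OF x'(2) st(6,2) ya] later by fastforce
    then show ?thesis using st(4) st(8)[OF st(2)] by simp
  qed
  have "blk_min x (blk_pt x a) = a" "blk_min x (blk_pt x b) = b"
    using blk_props(5)[OF assms(2)] st by auto
  then show "u \<longleftrightarrow> blk_pt y a = blk_pt x a" "\<not> u \<Longrightarrow> b = blk_min x (blk_pt y a)"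
    using pt st(1) by auto
  \<comment> \<open>Each absorbed block shows its minimum as the second entry of a label starting
    with \<open>a\<close>, and in the chain of 1-merges these entries increase from
    \<open>b\<close>.\<close>
  show "b \<le> blk_min x i" if "u" "i \<in> {1..n}" "blk_min y i = a" "blk_min x i \<noteq> a" for i
    using increasing_path_labels[OF assms firsts that(2-4)] later that(1) by fastforce
qed

lemma increasing_path_unique:
  "pp.path x v y \<Longrightarrow> pp.path x w y \<Longrightarrow> x \<in> pointed_partitions n \<Longrightarrow> sorted_wrt label_less v \<Longrightarrow>
      sorted_wrt label_less w \<Longrightarrow> v = w"
proof (induction v arbitrary: x w)
  case Nil
  then show ?case
  proof (cases w)
    case (Cons l w')
    obtain a b u where l: "l = (a, b, u)" by (cases l)
    have "blk_min x b = b" "blk_min x b = a" "a < b"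
      using increasing_path_first[of x a b u w' y] Nil Cons l by auto
    then show ?thesis by simp
  qed simp
next
  case (Cons l v)
  obtain a b u where l: "l = (a, b, u)" by (cases l)
  note first = increasing_path_first[OF Cons.prems(1)[unfolded l] Cons.prems(3) Cons.prems(4)[unfolded l]]
  show ?case
  proof (cases w)
    case Nil
    then show ?thesis using first Cons.prems(2) by auto
  next
    case w: (Cons k w')
    obtain c d t where k: "k = (c, d, t)" by (cases k)
    note first' = increasing_path_first[OF Cons.prems(2)[unfolded w k] Cons.prems(3) Cons.prems(5)[unfolded w k]]
    \<comment> \<open>The element \<open>d\<close> ends under the minimum \<open>c\<close>, which is
      not its old one, so \<open>c\<close> is among the values bounded below by \<open>a\<close>;
      symmetrically for \<open>b\<close>.\<close>
    have "a \<le> c" "c \<le> a"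
      using first(6)[OF first'(1)] first'(6)[OF first(1)] first(2-4) first'(2-4) by auto
    then have ac: "a = c" by simp
    then have ut: "u = t" using first(7) first'(7) by simp
    have "b = d"
    proof (cases u)
      case True
      then show ?thesis
        using first(9)[OF _ first'(1)] first'(9)[OF _ first(1)] first(2-4) first'(2-4) ac ut by auto
    next
      case False
      then show ?thesis using first(8) first'(8) ac ut by simp
    qed
    then have lk: "l = k" using ac ut l k by simp
    obtain x' where x': "pp_merge x l x'" "pp.path x' v y" using Cons.prems(1) by auto
    have "x' \<in> pointed_partitions n" using pp.step_closed[OF Cons.prems(3) x'(1)] .
    moreover have "pp.path x' w' y"
      using Cons.prems(2) pp.step_det[OF Cons.prems(3) x'(1)] lk unfolding w by auto
    ultimately have "v = w'" using Cons.IH[OF x'(2)] Cons.prems(4,5) w by simp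
    then show ?thesis using lk w by simp
  qed
qed

text \<open>The first label is chosen as any increasing path must have it: \<open>a\<close> is the
  least new minimum, and \<open>b\<close> and \<open>u\<close> depend on whether its point changes.
  One merge brings \<open>x\<close> closer to \<open>y\<close>, and the extremal choices make the
  label precede the rest of the path.\<close>

lemma increasing_path_exists:
  "pp_refines x y \<Longrightarrow> x \<in> pointed_partitions n \<Longrightarrow> y \<in> pointed_partitions n \<Longrightarrow> \<exists>w. pp.path x w y \<and>
      sorted_wrt label_less w"
proof (induction "card (pp_mins n x)" arbitrary: x rule: less_induct)
  case less
  note ref = less.prems(1) and x = less.prems(2) and y = less.prems(3)
  note px = blk_props[OF x] and py = blk_props[OF y]
  have ref_min: "blk_min y (blk_min x i) = blk_min y i"
    and ref_pt: "blk_pt x (blk_pt y i) = blk_pt y i" if "i \<in> {1..n}" for i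
    using ref that by (auto simp: pp_refines_def)
  show ?case
  proof (cases "\<forall>i\<in>{1..n}. blk_min y i = blk_min x i")
    case True
    have "x = y"
    proof (rule pointed_partition_eqI[OF x y])
      fix i assume i: "i \<in> {1..n}"
      have "blk_pt x (blk_pt y i) = blk_pt x i"
        using True i py(4,5)[OF i] by (intro blk_pt_cong[OF x]) auto
      then show "blk_min x i = blk_min y i \<and> blk_pt x i = blk_pt y i"
        using True i ref_pt by simp
    qed
    then show ?thesis by (intro exI[of _ "[]"]) simp
  next
    case False
    then obtain k where "k \<in> {1..n} \<and> blk_min y k \<noteq> blk_min x k" by blast
    from ex_has_least_nat[of "\<lambda>i. i \<in> {1..n} \<and> blk_min y i \<noteq> blk_min x i", OF this, of "blk_min y"]
    obtain j where j: "j \<in> {1..n}" "blk_min y j \<noteq> blk_min x j"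
      and least: "\<And>i. i \<in> {1..n} \<Longrightarrow> blk_min y i \<noteq> blk_min x i \<Longrightarrow> blk_min y j \<le> blk_min y i" by blast
    define a where "a = blk_min y j"
    have a: "a \<in> {1..n}" "blk_min y a = a" using py[OF j(1)] by (auto simp: a_def)
    have xa: "blk_min x a = a" using min_fixed_downward[OF y ref x a] .
    \<comment> \<open>If the point of the block of \<open>a\<close> is already right,
      \<open>b\<close> is the least block to be absorbed, by a 1-merge. Otherwise \<open>b\<close>
      is the block that holds the final point, absorbed by a 0-merge.\<close>
    have "\<exists>u b. b \<in> {1..n} \<and> blk_min x b = b \<and> blk_min y b = a \<and> b \<noteq> a \<and>
      (if u then blk_pt x a = blk_pt y a \<and> (\<forall>i\<in>{1..n}. blk_min y i =
          a \<longrightarrow> blk_min x i \<noteq> a \<longrightarrow> b \<le> blk_min x i)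
       else blk_pt x b = blk_pt y a)"
    proof (cases "blk_pt x a = blk_pt y a")
      case True
      have "j \<in> {1..n} \<and> blk_min y j = a \<and> blk_min x j \<noteq> a" using j by (simp add: a_def)
      from ex_has_least_nat[of "\<lambda>i. i \<in> {1..n} \<and> blk_min y i = a \<and> blk_min x i \<noteq> a", OF this, of
          "blk_min x"]
      obtain i where i: "i \<in> {1..n}" "blk_min y i = a" "blk_min x i \<noteq> a"
        "\<forall>k. k \<in> {1..n} \<and> blk_min y k = a \<and> blk_min x k \<noteq> a \<longrightarrow> blk_min x i \<le> blk_min x k" by blast
      show ?thesis
        by (rule exI[of _ True], rule exI[of _ "blk_min x i"])
          (use i True px[OF i(1)] ref_min[OF i(1)] in auto)
    next
      case False
      define r where "r = blk_pt y a"
      have r: "r \<in> {1..n}" "blk_min y r = a" "blk_pt x r = r"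
        using py[OF a(1)] ref_pt[OF a(1)] a(2) by (auto simp: r_def)
      have "blk_min x r \<noteq> a"
        using False r xa blk_pt_cong[OF x r(1) a(1)] by (auto simp: r_def)
      then show ?thesis
        by (intro exI[of _ False] exI[of _ "blk_min x r"])
          (use r px[OF r(1)] ref_min[OF r(1)] in \<open>auto simp: r_def\<close>)
    qed
    then obtain u b where b: "b \<in> {1..n}" "blk_min x b = b" "blk_min y b = a" "b \<noteq> a"
      and upt: "blk_pt y a = (if u then blk_pt x a else blk_pt x b)"
      and bleast: "\<And>i. u \<Longrightarrow> i \<in> {1..n} \<Longrightarrow> blk_min y i = a \<Longrightarrow> blk_min x i \<noteq> a \<Longrightarrow> b \<le> blk_min x i"
      by (metis (full_types))
    have ab: "a < b" using py(2)[OF b(1)] b(3,4) by simp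
    then obtain x' where x': "pp_merge x (a, b, u) x'"
      using ex_pp_merge_iff[OF x, of a b u] a(1) xa b by (auto simp: pp_mins_def)
    note st = step_maps[OF x x']
    have "pp_refines x' y" unfolding pp_refines_def
    proof (intro ballI conjI)
      fix i assume i: "i \<in> {1..n}"
      show "blk_min y (blk_min x' i) = blk_min y i"
        using st(7)[OF i] ref_min[OF i] a(2) b(3) by auto
      define r where "r = blk_pt y i"
      have r: "r \<in> {1..n}" "blk_min y r = blk_min y i" "blk_pt x r = r" "blk_pt y r = r"
        using py[OF i] ref_pt[OF i] blk_pt_idem[OF y i] by (auto simp: r_def)
      show "blk_pt x' (blk_pt y i) = blk_pt y i"
      proof (cases "blk_min x r = a \<or> blk_min x r = b")
        case True
        then have "blk_min y r = a" using ref_min[OF r(1)] a(2) b(3) by auto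
        then have "blk_pt y a = r" using blk_pt_cong[OF y a(1) r(1)] a(2) r(4) by simp
        then show ?thesis using st(8)[OF r(1)] True upt by (simp flip: r_def)
      next
        case False
        then show ?thesis using st(8)[OF r(1)] r(3) by (simp flip: r_def)
      qed
    qed
    moreover have "card (pp_mins n x') < card (pp_mins n x)"
    proof -
      have "pp_mins n x' = pp_mins n x - {b}" using pp.step_mins[OF x x'] .
      moreover have "b \<in> pp_mins n x" "finite (pp_mins n x)" using b by (auto simp: pp_mins_def)
      ultimately show ?thesis by (metis card_Diff1_less)
    qed
    ultimately obtain w where w: "pp.path x' w y" "sorted_wrt label_less w"
      using less.hyps st(6) y by blast
    have "successively label_less ((a, b, u) # w)"
    proof (cases w)
      case (Cons l w')
      obtain c d v where l: "l = (c, d, v)" by (cases l)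
      note first = increasing_path_first[OF w(1)[unfolded Cons l] st(6) w(2)[unfolded Cons l]]
      have "blk_min x d \<noteq> b" using st(7)[OF first(1)] first(2,3,4) a(2) by auto
      then have xd: "blk_min x d = d" using st(7)[OF first(1)] first(3) by simp
      then have "d \<noteq> b" using \<open>blk_min x d \<noteq> b\<close> by simp
      have "a \<le> c" using least[OF first(1)] xd first(2,4) by (simp add: a_def)
      \<comment> \<open>Whatever \<open>u\<close> is, the first merge has already given the block of
        \<open>a\<close> its final point, so a next merge into this block has to keep it.\<close>
      moreover have v if "a = c"
        using first(7) that upt st(8)[OF a(1)] xa by simp
      moreover have "b < d" if "a = c" u
        using bleast[OF that(2) first(1)] that(1) first(2,4) xd \<open>d \<noteq> b\<close> by simp
      ultimately have "label_less (a, b, u) l" unfolding l label_less.simps by (cases "a =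
          c"; cases u) auto
      then show ?thesis using w(2) successively_if_sorted_wrt[of label_less w] by (simp add: Cons)
    qed simp
    moreover have "transp label_less" by (rule transpI) (rule label_less_trans)
    ultimately have "sorted_wrt label_less ((a, b, u) # w)"
      by (metis successively_conv_sorted_wrt transpD)
    then show ?thesis using x' w(1) by (intro exI[of _ "(a, b, u) # w"]) auto
  qed
qed

lemma increasing_path_ex1:
  assumes "x \<in> pointed_partitions n" "pp.path x w y"
  shows "\<exists>!v. pp.path x v y \<and> successively label_less v"
proof -
  have iff: "successively label_less v \<longleftrightarrow> sorted_wrt label_less v" for v
    by (rule successively_conv_sorted_wrt) (auto intro!: transpI dest: label_less_trans)
  show ?thesis unfolding iff
    using increasing_path_exists[OF path_refines[OF assms(2,1)] assms(1) pp.path_closed[OF assms(2,1)]]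
      increasing_path_unique assms(1) by blast
qed

lemma pp_reachable:
  assumes "y \<in> pointed_partitions n"
  shows "\<exists>w. pp.path (singletons_pp n) w y"
proof -
  have "pp_refines (singletons_pp n) y"
    using singletons_pp(2,3) blk_props[OF assms] by (auto simp: pp_refines_def)
  then show ?thesis using increasing_path_exists singletons_pp(1) assms by blast
qed

end

interpretation pp: reachable_merge_system n "pointed_partitions n" pp_merge "pp_mins n"
    "singletons_pp n" for n
  by unfold_locales (rule pp_reachable)

lemma pp_le_eq: "pp.le n = Pi_pointed n"
  by (simp add: pp.le_def Pi_pointed_def)

lemma pp_lam_eq: "pp.lam = lambda_pointed"
  by (intro ext) (simp add: pp.lam_def lambda_pointed_def)

section \<open>Pointed Lyndon forests as a merge system\<close>

text \<open>The failure of the pointed Lyndon condition between a new root and its left child,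
  written as an ascent of merge labels. Both labels have the same first entry by normalization; the
  dummy 0 stands for it.\<close>

fun passes :: "btree \<Rightarrow> nat \<Rightarrow> bool \<Rightarrow> bool" where
  "passes (Leaf a) b u \<longleftrightarrow> False"
| "passes (Node c l r) b u \<longleftrightarrow> label_less (0, valency r, c) (0, b, u)"

text \<open>The slide loop as a recursion: the new vertex, with right subtree \<open>y\<close>,
  descends the leftmost path past all vertices whose labels lie below its own, as in insertion
  sort.\<close>

fun insert_tree :: "bool \<Rightarrow> btree \<Rightarrow> btree \<Rightarrow> btree" where
  "insert_tree u (Leaf a) y = Node u (Leaf a) y"
| "insert_tree u (Node c l r) y =
     (if passes (Node c l r) (valency y) u then Node c (insert_tree u l y) r else Node u (Node c l r) y)"

lemma leaves_nonempty [simp]: "leaves t \<noteq> []"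
  by (induction t) auto

lemma valency_in_leaves: "valency t \<in> set (leaves t)"
  unfolding valency_def by (rule Min_in) auto

lemma valency_Leaf [simp]: "valency (Leaf a) = a"
  by (simp add: valency_def)

lemma valency_Node [simp]: "valency (Node u l r) = min (valency l) (valency r)"
  by (simp add: valency_def Min_Un)

lemma pointed_lyndon_Leaf [simp]: "pointed_lyndon_tree (Leaf a)"
  by (simp add: pointed_lyndon_tree_def normalized_def)

text \<open>The Lyndon condition is a strict inequality of valencies, and its negation is strict as
  well, since disjoint leaf sets exclude equality. This lets the condition agree with the negation
  of \<open>passes\<close>.\<close>

lemma pointed_lyndon_Node:
  "pointed_lyndon_tree (Node u l r) \<longleftrightarrow> pointed_lyndon_tree l \<and> pointed_lyndon_tree r \<and>
     set (leaves l) \<inter> set (leaves r) = {} \<and> valency l < valency r \<and> \<not> passes l (valency r) u"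
proof (cases "set (leaves l) \<inter> set (leaves r) = {}")
  case True
  have ne: "valency l \<noteq> valency r"
    using True valency_in_leaves[of l] valency_in_leaves[of r] by auto
  have ne': "valency (right l) \<noteq> valency r" if "is_internal l"
    using True valency_in_leaves[of "right l"] valency_in_leaves[of r] that by (cases l) auto
  have norm: "normalized (Node u l r) \<longleftrightarrow> valency l < valency r \<and> normalized l \<and> normalized r"
    using ne by (auto simp: normalized_def min_def)
  have root: "(is_internal l \<longrightarrow> color l \<ge> u \<and> (color l = True \<and> u =
      True \<longrightarrow> lyndon_vertex (Node u l r)))
      \<longleftrightarrow> \<not> passes l (valency r) u"
    using ne' by (cases l) (auto simp: lyndon_vertex_def)
  show ?thesis
    unfolding pointed_lyndon_tree_def norm internal_subtrees.simps ball_simps ball_Un btree.sel root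
    using True by auto
qed (auto simp: pointed_lyndon_tree_def)

lemma insert_tree_no_pass: "\<not> passes s (valency y) u \<Longrightarrow> insert_tree u s y = Node u s y"
  by (cases s) (simp_all del: passes.simps)

lemma leaves_insert_tree: "set (leaves (insert_tree u s y)) = set (leaves s) \<union> set (leaves y)"
  by (induction s) auto

lemma valency_insert_tree: "valency (insert_tree u s y) = min (valency s) (valency y)"
  by (simp add: valency_def leaves_insert_tree Min_Un)

lemma pointed_lyndon_insert_tree:
  "pointed_lyndon_tree s \<Longrightarrow> pointed_lyndon_tree y \<Longrightarrow> set (leaves s) \<inter> set (leaves y) = {} \<Longrightarrow>
    valency s < valency y \<Longrightarrow> pointed_lyndon_tree (insert_tree u s y)"
proof (induction s)
  case (Node c l r)
  show ?case
  proof (cases "passes (Node c l r) (valency y) u")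
    case True
    have l: "pointed_lyndon_tree l" "pointed_lyndon_tree r" "set (leaves l) \<inter> set (leaves r) = {}"
      "valency l < valency r" "\<not> passes l (valency r) c"
      using Node.prems(1) by (auto simp: pointed_lyndon_Node)
    \<comment> \<open>The new left child of the passed vertex is either the old one, with the same
      color and right subtree, or the new vertex itself, whose label is the larger one.\<close>
    have "\<not> passes (insert_tree u l y) (valency r) c"
    proof (cases "passes l (valency y) u")
      case True
      then show ?thesis using l(5) by (cases l) auto
    next
      case False
      then show ?thesis using True by (auto simp: insert_tree_no_pass)
    qed
    then show ?thesis using True l Node.prems Node.IH(1)
      by (auto simp: pointed_lyndon_Node leaves_insert_tree valency_insert_tree)
  next
    case False
    then show ?thesis
      using Node.prems unfolding insert_tree_no_pass[OF False] pointed_lyndon_Node[of u] by simp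
  qed
qed (simp add: pointed_lyndon_Node)

text \<open>The vertex of \<open>z\<close> passes every vertex that the vertex of \<open>y\<close>
  passes, and also the latter vertex itself; so in either order \<open>z\<close> ends below
  \<open>y\<close> on the leftmost path.\<close>

lemma insert_tree_commute:
  assumes "label_less (0, valency y, u) (0, valency z, v)"
  shows "insert_tree v (insert_tree u s y) z = insert_tree u (insert_tree v s z) y"
proof (induction s)
  case (Leaf a)
  then show ?case using assms by auto
next
  case (Node c l r)
  have "passes (Node c l r) (valency y) u \<Longrightarrow> passes (Node c l r) (valency z) v"
    using assms label_less_trans by auto
  then show ?case using assms Node.IH(1) by auto
qed

text \<open>An invariant that reveals the color of the inserted vertex, wherever it comes to
  rest.\<close>

fun count_true :: "btree \<Rightarrow> nat" where
  "count_true (Leaf a) = 0"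
| "count_true (Node u l r) = of_bool u + count_true l + count_true r"

lemma count_true_insert_tree: "count_true (insert_tree u s y) =
    of_bool u + count_true s + count_true y"
  by (induction s) auto

lemma insert_tree_color_inj: "insert_tree u s y = insert_tree v s y \<Longrightarrow> u = v"
  using count_true_insert_tree[of u s y] count_true_insert_tree[of v s y] by (cases u; cases v) auto

text \<open>A zipper for the leftmost path: the list records the vertices already passed, and its
  length is the depth counter of the slide loop.\<close>

fun plug_left :: "(bool \<times> btree) list \<Rightarrow> btree \<Rightarrow> btree" where
  "plug_left [] t = t"
| "plug_left ((c, r) # xs) t = Node c (plug_left xs t) r"

lemma plug_left_append: "plug_left (xs @ ys) t = plug_left xs (plug_left ys t)"
  by (induction xs) auto

lemma slide_at_plug_left:
  "slide_at (length xs) (plug_left xs (Node u (Node c l r) y)) =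
      plug_left (xs @ [(c, r)]) (Node u l y)"
  by (induction xs) auto

lemma pointed_lyndon_plug_left: "pointed_lyndon_tree (plug_left xs t) \<Longrightarrow> pointed_lyndon_tree t"
  by (induction xs t rule: plug_left.induct) (auto simp: pointed_lyndon_Node)

text \<open>The loop tests the whole tree, but the moving vertex is the only possible defect: if it
  must pass its left child, the whole tree fails; if not, the tree is already the final one, which
  is pointed Lyndon by assumption.\<close>

lemma while_slide:
  "pointed_lyndon_tree (plug_left xs (insert_tree u s y)) \<Longrightarrow>
    snd (while (\<lambda>(k, t). \<not> pointed_lyndon_tree t) (\<lambda>(k, t). (Suc k, slide_at k t))
      (length xs, plug_left xs (Node u s y))) = plug_left xs (insert_tree u s y)"
proof (induction s arbitrary: xs)
  case (Leaf a)
  then show ?case by (subst while_unfold) simp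
next
  case (Node c l r)
  show ?case
  proof (cases "passes (Node c l r) (valency y) u")
    case True
    then have "\<not> pointed_lyndon_tree (plug_left xs (Node u (Node c l r) y))"
      using pointed_lyndon_plug_left pointed_lyndon_Node by blast
    then show ?thesis
      using Node.IH(1)[of "xs @ [(c, r)]"] Node.prems True
      by (subst while_unfold) (simp add: slide_at_plug_left plug_left_append)
  next
    case False
    then show ?thesis
      using Node.prems unfolding insert_tree_no_pass[OF False] by (subst while_unfold) simp
  qed
qed

lemma tree_merge_eq:
  assumes "pointed_lyndon_tree s" "pointed_lyndon_tree y" "set (leaves s) \<inter> set (leaves y) = {}"
    "valency s < valency y"
  shows "tree_merge u s y = insert_tree u s y"
  unfolding tree_merge_def
  using while_slide[of "[]" u s y] pointed_lyndon_insert_tree[OF assms] by simp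

section \<open>Forests and their merges\<close>

lemma pointed_lyndon_forests_iff:
  "F \<in> pointed_lyndon_forests n \<longleftrightarrow>
     (\<forall>t\<in>F. pointed_lyndon_tree t \<and> set (leaves t) \<subseteq> {1..n}) \<and>
     (\<forall>i\<in>{1..n}. \<exists>!t. t \<in> F \<and> i \<in> set (leaves t))"
  (is "_ \<longleftrightarrow> ?P \<and> ?Q")
proof
  let ?l = "\<lambda>t. set (leaves t)"
  assume F: "F \<in> pointed_lyndon_forests n"
  then have inj: "inj_on ?l F" and U: "\<Union>(?l ` F) = {1..n}" and disj: "disjoint (?l ` F)"
    by (auto simp: pointed_lyndon_forests_def partition_on_def)
  have "?P" using F U by (auto simp: pointed_lyndon_forests_def)
  moreover have "?Q"
  proof
    fix i assume "i \<in> {1..n}"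
    then obtain t where t: "t \<in> F" "i \<in> ?l t" using U by blast
    moreover have "t' = t" if "t' \<in> F" "i \<in> ?l t'" for t'
    proof -
      have "?l t' = ?l t" using disj that t by (auto simp: disjoint_def)
      then show ?thesis using inj that t by (auto dest: inj_onD)
    qed
    ultimately show "\<exists>!t. t \<in> F \<and> i \<in> ?l t" by blast
  qed
  ultimately show "?P \<and> ?Q" ..
next
  let ?l = "\<lambda>t. set (leaves t)"
  assume *: "?P \<and> ?Q"
  have uniq: "s = t" if "s \<in> F" "t \<in> F" "i \<in> ?l s" "i \<in> ?l t" for s t i
  proof -
    have "i \<in> {1..n}" using * that by blast
    with * have "\<exists>!t. t \<in> F \<and> i \<in> ?l t" by blast
    then show ?thesis using that by blast
  qed
  have "inj_on ?l F"
    by (rule inj_onI) (metis uniq valency_in_leaves)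
  moreover have "disjoint (?l ` F)"
    using uniq by (auto simp: disjoint_def)
  moreover have "{} \<notin> ?l ` F" by auto
  moreover have "\<Union>(?l ` F) = {1..n}"
  proof
    show "\<Union>(?l ` F) \<subseteq> {1..n}" using * by blast
    show "{1..n} \<subseteq> \<Union>(?l ` F)" using * by blast
  qed
  ultimately show "F \<in> pointed_lyndon_forests n"
    using * by (auto simp: pointed_lyndon_forests_def partition_on_def)
qed

lemma forest_treeD:
  assumes "F \<in> pointed_lyndon_forests n" "t \<in> F"
  shows "pointed_lyndon_tree t" "set (leaves t) \<subseteq> {1..n}"
  using assms unfolding pointed_lyndon_forests_iff by blast+

lemma forest_tree_unique:
  assumes "F \<in> pointed_lyndon_forests n" "s \<in> F" "t \<in> F" "i \<in> set (leaves s)" "i \<in> set (leaves t)"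
  shows "s = t"
proof -
  have "i \<in> {1..n}" using forest_treeD(2)[OF assms(1,2)] assms(4) by blast
  then have "\<exists>!t. t \<in> F \<and> i \<in> set (leaves t)"
    using assms(1) unfolding pointed_lyndon_forests_iff by blast
  then show ?thesis using assms by blast
qed

lemma forest_valency_inj:
  "F \<in> pointed_lyndon_forests n \<Longrightarrow> s \<in> F \<Longrightarrow> t \<in> F \<Longrightarrow> valency s = valency t \<Longrightarrow> s = t"
  by (metis forest_tree_unique valency_in_leaves)

definition forest_merge :: "btree set \<Rightarrow> label \<Rightarrow> btree set \<Rightarrow> bool" where
  "forest_merge F l F' \<longleftrightarrow> (\<exists>t1\<in>F. \<exists>t2\<in>F. \<exists>u. valency t1 < valency t2 \<and> l =
      (valency t1, valency t2, u) \<and>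
     F' = insert (tree_merge u t1 t2) (F - {t1, t2}))"

lemma replace_two_trees:
  assumes F: "F \<in> pointed_lyndon_forests n" and t: "t1 \<in> F" "t2 \<in> F" "t1 \<noteq> t2"
    and T: "pointed_lyndon_tree T" "set (leaves T) = set (leaves t1) \<union> set (leaves t2)"
  shows "insert T (F - {t1, t2}) \<in> pointed_lyndon_forests n" "T \<notin> F"
proof -
  show "T \<notin> F"
  proof
    assume "T \<in> F"
    then have "T = t1" "T = t2"
      using forest_tree_unique[OF F, of T] t T(2) valency_in_leaves UnI1 UnI2 by metis+
    then show False using t(3) by simp
  qed
  show "insert T (F - {t1, t2}) \<in> pointed_lyndon_forests n"
    unfolding pointed_lyndon_forests_iff
  proof
    show "\<forall>t\<in>insert T (F - {t1, t2}). pointed_lyndon_tree t \<and> set (leaves t) \<subseteq> {1..n}"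
      using forest_treeD[OF F] t T by blast
    show "\<forall>i\<in>{1..n}. \<exists>!t. t \<in> insert T (F - {t1, t2}) \<and> i \<in> set (leaves t)"
    proof
      fix i assume "i \<in> {1..n}"
      then obtain s where s: "s \<in> F" "i \<in> set (leaves s)"
        using F unfolding pointed_lyndon_forests_iff by blast
      then have uniq: "s' = s" if "s' \<in> F" "i \<in> set (leaves s')" for s'
        using forest_tree_unique[OF F] that by blast
      show "\<exists>!t. t \<in> insert T (F - {t1, t2}) \<and> i \<in> set (leaves t)"
      proof (cases "s = t1 \<or> s = t2")
        case True
        show ?thesis
        proof (rule ex1I[of _ T])
          show "T \<in> insert T (F - {t1, t2}) \<and> i \<in> set (leaves T)" using True s(2) T(2) by auto
          fix t assume "t \<in> insert T (F - {t1, t2}) \<and> i \<in> set (leaves t)"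
          then show "t = T" using uniq[of t] True by blast
        qed
      next
        case False
        have "i \<notin> set (leaves T)" using False uniq[OF t(1)] uniq[OF t(2)] T(2) by auto
        with False s uniq show ?thesis by blast
      qed
    qed
  qed
qed

lemma forest_merge_trees:
  assumes F: "F \<in> pointed_lyndon_forests n" and t: "t1 \<in> F" "t2 \<in> F" "valency t1 < valency t2"
  shows "set (leaves t1) \<inter> set (leaves t2) = {}" "tree_merge u t1 t2 = insert_tree u t1 t2"
    "insert (insert_tree u t1 t2) (F - {t1, t2}) \<in> pointed_lyndon_forests n"
    "insert_tree u t1 t2 \<notin> F" "valency (insert_tree u t1 t2) = valency t1"
proof -
  have "t1 \<noteq> t2" using t by auto
  then show disj: "set (leaves t1) \<inter> set (leaves t2) = {}" using forest_tree_unique[OF F] t by blast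
  note p = forest_treeD(1)[OF F t(1)] forest_treeD(1)[OF F t(2)] disj t(3)
  show "tree_merge u t1 t2 = insert_tree u t1 t2" by (rule tree_merge_eq[OF p])
  show "insert (insert_tree u t1 t2) (F - {t1, t2}) \<in> pointed_lyndon_forests n"
      "insert_tree u t1 t2 \<notin> F"
    using replace_two_trees[OF F t(1,2) \<open>t1 \<noteq> t2\<close> pointed_lyndon_insert_tree[OF p] leaves_insert_tree] by auto
  show "valency (insert_tree u t1 t2) = valency t1" using t by (simp add: valency_insert_tree)
qed

lemma forest_merge_iff:
  assumes F: "F \<in> pointed_lyndon_forests n"
  shows "forest_merge F (a, b, u) F' \<longleftrightarrow> (\<exists>t1\<in>F. \<exists>t2\<in>F. valency t1 = a \<and> valency t2 = b \<and> a < b \<and>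
    F' = insert (insert_tree u t1 t2) (F - {t1, t2}))"
proof
  assume "forest_merge F (a, b, u) F'"
  then obtain t1 t2 where t: "t1 \<in> F" "t2 \<in> F" "valency t1 < valency t2" "a = valency t1" "b =
      valency t2"
    "F' = insert (tree_merge u t1 t2) (F - {t1, t2})" by (auto simp: forest_merge_def)
  then show "\<exists>t1\<in>F. \<exists>t2\<in>F. valency t1 = a \<and> valency t2 = b \<and> a < b \<and>
      F' = insert (insert_tree u t1 t2) (F - {t1, t2})"
    using forest_merge_trees(2)[OF F t(1-3)] by (intro bexI[of _ t1] bexI[of _ t2]) auto
next
  assume "\<exists>t1\<in>F. \<exists>t2\<in>F. valency t1 = a \<and> valency t2 = b \<and> a < b \<and>
      F' = insert (insert_tree u t1 t2) (F - {t1, t2})"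
  then obtain t1 t2 where t: "t1 \<in> F" "t2 \<in> F" "valency t1 < valency t2" "a = valency t1" "b =
      valency t2"
    "F' = insert (insert_tree u t1 t2) (F - {t1, t2})" by auto
  then show "forest_merge F (a, b, u) F'"
    unfolding forest_merge_def using forest_merge_trees(2)[OF F t(1-3)]
    by (intro bexI[of _ t1] bexI[of _ t2] exI[of _ u]) auto
qed

definition leaf_forest :: "nat \<Rightarrow> btree set" where
  "leaf_forest n = Leaf ` {1..n}"

interpretation fl: merge_system n "pointed_lyndon_forests n" forest_merge "\<lambda>F. valency ` F"
    "leaf_forest n" for n
proof
  show "leaf_forest n \<in> pointed_lyndon_forests n"
    by (auto simp: pointed_lyndon_forests_iff leaf_forest_def)
  show "valency ` leaf_forest n = {1..n}"
    by (auto simp: leaf_forest_def image_image)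
  fix F assume F: "F \<in> pointed_lyndon_forests n"
  show closed: "F' \<in> pointed_lyndon_forests n" if "forest_merge F l F'" for l F'
    using that forest_merge_trees(3)[OF F] by (cases l) (auto simp: forest_merge_iff[OF F])
  show "(\<exists>F'. forest_merge F (a, b, u) F') \<longleftrightarrow> a < b \<and> a \<in> valency ` F \<and> b \<in> valency ` F" for a b u
    by (auto simp: forest_merge_iff[OF F])
  show mins: "valency ` F' = valency ` F - {b}" if m: "forest_merge F (a, b, u) F'" for a b u F'
  proof -
    obtain t1 t2 where t: "t1 \<in> F" "t2 \<in> F" "valency t1 = a" "valency t2 = b" "a < b"
      "F' = insert (insert_tree u t1 t2) (F - {t1, t2})" using m
          by (auto simp: forest_merge_iff[OF F])
    have "valency (insert_tree u t1 t2) = a" using forest_merge_trees(5)[OF F t(1,2)] t by simp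
    then have "valency ` F' = insert a (valency ` (F - {t1, t2}))" using t(6) by simp
    also have "valency ` (F - {t1, t2}) = valency ` F - {a, b}"
      using forest_valency_inj[OF F] t(1-4) by blast
    finally show ?thesis using t(1,3,5) by auto
  qed
  show "F' = F''" if "forest_merge F l F'" "forest_merge F l F''" for l F' F''
  proof (cases l)
    case (fields a b u)
    then show ?thesis
      using that forest_valency_inj[OF F] unfolding fields forest_merge_iff[OF F] by metis
  qed
  show "l = l'" if m: "forest_merge F l F'" "forest_merge F l' F'" for l l' F'
  proof -
    obtain a b u where l: "l = (a, b, u)" by (cases l)
    obtain c d v where l': "l' = (c, d, v)" by (cases l')
    obtain t1 t2 where t: "t1 \<in> F" "t2 \<in> F" "valency t1 = a" "valency t2 = b" "a < b"
      "F' = insert (insert_tree u t1 t2) (F - {t1, t2})" using m(1)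
          by (auto simp: l forest_merge_iff[OF F])
    obtain s1 s2 where s: "s1 \<in> F" "s2 \<in> F" "valency s1 = c" "valency s2 = d" "c < d"
      "F' = insert (insert_tree v s1 s2) (F - {s1, s2})" using m(2)
          by (auto simp: l' forest_merge_iff[OF F])
    have new: "insert_tree u t1 t2 \<notin> F" "insert_tree v s1 s2 \<notin> F"
      using forest_merge_trees(4)[OF F] t s by auto
    \<comment> \<open>The merged tree is new, so \<open>F - F'\<close> is the pair of old trees,
      ordered by valency, and \<open>F' - F\<close> is the merged tree, from which the color can be
      recovered.\<close>
    have "F - F' = {t1, t2}" using new(1) t(1,2) unfolding t(6) by auto
    moreover have "F - F' = {s1, s2}" using new(2) s(1,2) unfolding s(6) by auto
    ultimately have "{t1, t2} = {s1, s2}" by simp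
    then have ts: "t1 = s1" "t2 = s2" using t(3-5) s(3-5) by (auto simp: doubleton_eq_iff)
    have "F' - F = {insert_tree u t1 t2}" using new(1) unfolding t(6) by blast
    moreover have "F' - F = {insert_tree v s1 s2}" using new(2) unfolding s(6) by blast
    ultimately have "u = v" using ts insert_tree_color_inj[of u t1 t2 v] by simp
    then show ?thesis using ts t s l l' by simp
  qed
  show "\<exists>F1'. forest_merge F l' F1' \<and> forest_merge F1' l F2"
    if m: "forest_merge F l F1" "forest_merge F1 l' F2" "label_less l l'" for l l' F1 F2
  proof -
    obtain a b u where l: "l = (a, b, u)" by (cases l)
    obtain c d v where l': "l' = (c, d, v)" by (cases l')
    have F1: "F1 \<in> pointed_lyndon_forests n" using closed m(1) .
    obtain ta tb where ab: "ta \<in> F" "tb \<in> F" "valency ta = a" "valency tb = b" "a < b"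
      "F1 = insert (insert_tree u ta tb) (F - {ta, tb})" using m(1)
          by (auto simp: l forest_merge_iff[OF F])
    define T where "T = insert_tree u ta tb"
    have T: "valency T = a" "T \<notin> F" using forest_merge_trees[OF F ab(1,2)] ab by (auto simp: T_def)
    obtain tc td where cd: "tc \<in> F1" "td \<in> F1" "valency tc = c" "valency td = d" "c < d"
      "F2 = insert (insert_tree v tc td) (F1 - {tc, td})" using m(2)
          by (auto simp: l' forest_merge_iff[OF F1])
    have ac: "a \<le> c" using m(3) by (auto simp: l l')
    then have td: "td \<in> F" "td \<noteq> ta" "td \<noteq> tb" "td \<noteq> T" using ab cd T
        by (auto simp: T_def[symmetric])
    show ?thesis
    \<comment> \<open>For \<open>a \<noteq> c\<close> the two merges involve four different trees of
      \<open>F\<close> and commute trivially; otherwise both insert into the tree with minimum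
      \<open>a\<close>.\<close>
    proof (cases "a = c")
      case False
      then have tc: "tc \<in> F" "tc \<noteq> ta" "tc \<noteq> tb" "tc \<noteq> T" using ab cd T
          by (auto simp: T_def[symmetric])
      define U where "U = insert_tree v tc td"
      have U: "U \<notin> F" using forest_merge_trees(4)[OF F tc(1) td(1)] cd by (auto simp: U_def)
      define F1' where "F1' = insert U (F - {tc, td})"
      have m1: "forest_merge F l' F1'"
        unfolding l' forest_merge_iff[OF F] using tc td cd by (auto simp: F1'_def U_def)
      have F1': "F1' \<in> pointed_lyndon_forests n" using closed m1 .
      have "F2 = insert T (F1' - {ta, tb})"
        unfolding F1'_def cd(6) ab(6) U_def[symmetric] T_def[symmetric]
        using T U ab(1,2) tc td by blast
      moreover have "ta \<in> F1'" "tb \<in> F1'" using ab tc td by (auto simp: F1'_def)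
      ultimately have "forest_merge F1' l F2"
        unfolding l forest_merge_iff[OF F1'] using ab by (auto simp: T_def)
      with m1 show ?thesis by blast
    next
      case True
      have tc: "tc = T" using forest_valency_inj[OF F1 cd(1), of T] T True cd(3) ab(6)
          by (auto simp: T_def)
      define U where "U = insert_tree v ta td"
      have U: "valency U = a" "U \<notin> F"
        using forest_merge_trees(4,5)[OF F ab(1) td(1)] cd ab True by (auto simp: U_def)
      define F1' where "F1' = insert U (F - {ta, td})"
      have m1: "forest_merge F l' F1'"
        unfolding l' forest_merge_iff[OF F] using td cd ab True by (auto simp: F1'_def U_def)
      have F1': "F1' \<in> pointed_lyndon_forests n" using closed m1 .
      have "label_less (0, valency tb, u) (0, valency td, v)"
        using m(3) True ab cd by (auto simp: l l')
      then have "insert_tree v T td = insert_tree u U tb"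
        unfolding T_def U_def by (rule insert_tree_commute)
      then have "F2 = insert (insert_tree u U tb) (F1' - {U, tb})"
        unfolding F1'_def cd(6) ab(6) tc T_def[symmetric]
        using T U ab(1,2) td by auto
      moreover have "tb \<in> F1'" "U \<in> F1'" using ab td by (auto simp: F1'_def)
      ultimately have "forest_merge F1' l F2"
        unfolding l forest_merge_iff[OF F1'] using ab U by blast
      with m1 show ?thesis by blast
    qed
  qed
qed

section \<open>Reachability of forests\<close>

lemma forest_Leaf_only:
  assumes "F \<in> pointed_lyndon_forests n" "\<forall>t\<in>F. is_Leaf t"
  shows "F = leaf_forest n"
proof
  show "F \<subseteq> leaf_forest n"
  proof
    fix t assume t: "t \<in> F"
    then obtain a where "t = Leaf a" using assms(2) by (cases t) auto
    then show "t \<in> leaf_forest n" using forest_treeD(2)[OF assms(1) t]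
        by (auto simp: leaf_forest_def)
  qed
  show "leaf_forest n \<subseteq> F"
  proof
    fix t assume "t \<in> leaf_forest n"
    then obtain i where i: "i \<in> {1..n}" "t = Leaf i" by (auto simp: leaf_forest_def)
    then obtain s where s: "s \<in> F" "i \<in> set (leaves s)"
      using assms(1) unfolding pointed_lyndon_forests_iff by blast
    then have "s = Leaf i" using assms(2) by (cases s) auto
    then show "t \<in> F" using s i by simp
  qed
qed

text \<open>The root of a pointed Lyndon tree does not have to pass its left child, so merging its
  two subtrees again involves no slide.\<close>

lemma split_root:
  assumes F: "F \<in> pointed_lyndon_forests n" and N: "Node u l r \<in> F"
  shows "insert l (insert r (F - {Node u l r})) \<in> pointed_lyndon_forests n" (is "?G \<in> _")
    and "forest_merge (insert l (insert r (F - {Node u l r}))) (valency l, valency r, u) F"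
proof -
  let ?N = "Node u l r"
  have lr: "pointed_lyndon_tree l" "pointed_lyndon_tree r" "set (leaves l) \<inter> set (leaves r) = {}"
    "valency l < valency r" "\<not> passes l (valency r) u"
    using forest_treeD(1)[OF F N] by (auto simp: pointed_lyndon_Node)
  have uniq: "t = ?N" if "t \<in> F" "i \<in> set (leaves t)" "i \<in> set (leaves l) \<union> set (leaves r)" for t i
    using forest_tree_unique[OF F that(1) N that(2)] that(3) by simp
  show G: "?G \<in> pointed_lyndon_forests n"
    unfolding pointed_lyndon_forests_iff
  proof
    show "\<forall>t\<in>?G. pointed_lyndon_tree t \<and> set (leaves t) \<subseteq> {1..n}"
      using forest_treeD[OF F] forest_treeD(2)[OF F N] lr by auto
    show "\<forall>i\<in>{1..n}. \<exists>!t. t \<in> ?G \<and> i \<in> set (leaves t)"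
    proof
      fix i assume "i \<in> {1..n}"
      then obtain s where s: "s \<in> F" "i \<in> set (leaves s)"
        using F unfolding pointed_lyndon_forests_iff by blast
      consider "i \<in> set (leaves l)" | "i \<in> set (leaves r)" | "s \<noteq> ?N"
        using s(2) by (cases "s = ?N") auto
      then show "\<exists>!t. t \<in> ?G \<and> i \<in> set (leaves t)"
      proof cases
        case 1
        have "t = l" if "t \<in> ?G" "i \<in> set (leaves t)" for t
          using that uniq[of t i] 1 lr(3) by blast
        then show ?thesis using 1 by blast
      next
        case 2
        have "t = r" if "t \<in> ?G" "i \<in> set (leaves t)" for t
          using that uniq[of t i] 2 lr(3) by blast
        then show ?thesis using 2 by blast
      next
        case 3
        have "i \<notin> set (leaves l) \<union> set (leaves r)" using uniq[OF s] 3 by blast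
        then have "t = s" if "t \<in> ?G" "i \<in> set (leaves t)" for t
          using that forest_tree_unique[OF F _ s(1) _ s(2)] by blast
        then show ?thesis using s 3 by blast
      qed
    qed
  qed
  have notin: "t \<notin> F" if t: "t = l \<or> t = r" for t
  proof
    assume "t \<in> F"
    then have "t = ?N" using t uniq[of t "valency t"] valency_in_leaves[of t] by blast
    then have "size t = size ?N" by (rule arg_cong)
    then show False using t by auto
  qed
  have "insert_tree u l r = ?N" by (rule insert_tree_no_pass[OF lr(5)])
  moreover have "F = insert ?N (?G - {l, r})" using notin[of l] notin[of r] N by blast
  ultimately have eq: "F = insert (insert_tree u l r) (?G - {l, r})" by (simp only:)
  show "forest_merge ?G (valency l, valency r, u) F"
    unfolding forest_merge_iff[OF G]
    by (intro bexI[of _ l] bexI[of _ r] conjI refl lr(4) eq insertI1 insertI2)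
qed

text \<open>Roots are removed one at a time until only leaves remain; each removal adds a tree,
  hence a valency.\<close>

lemma forest_reachable: "F \<in> pointed_lyndon_forests n \<Longrightarrow> \<exists>w. fl.path (leaf_forest n) w F"
proof (induction "n - card (valency ` F)" arbitrary: F rule: less_induct)
  case less
  show ?case
  proof (cases "\<forall>t\<in>F. is_Leaf t")
    case True
    then show ?thesis using forest_Leaf_only[OF less.prems] by (intro exI[of _ "[]"]) simp
  next
    case False
    then obtain u l r where N: "Node u l r \<in> F" by (metis btree.collapse(2))
    define G where "G = insert l (insert r (F - {Node u l r}))"
    have G: "G \<in> pointed_lyndon_forests n" "forest_merge G (valency l, valency r, u) F"
      using split_root[OF less.prems N] by (auto simp: G_def)
    have "valency ` G \<subseteq> {1..n}"
      using forest_treeD(2)[OF G(1)] valency_in_leaves by blast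
    then have "finite (valency ` G)" "card (valency ` G) \<le> n"
      using card_mono[of "{1..n}" "valency ` G"] by (auto intro: finite_subset)
    moreover have "valency ` F = valency ` G - {valency r}" using fl.step_mins[OF G] .
    moreover have "valency r \<in> valency ` G" by (simp add: G_def)
    ultimately have "n - card (valency ` G) < n - card (valency ` F)"
      by (metis card_Diff1_less diff_less_mono2 less_le_trans)
    then obtain w where "fl.path (leaf_forest n) w G" using less.hyps G(1) by blast
    then show ?thesis using G(2) by (intro exI[of _ "w @ [(valency l, valency r, u)]"]) (auto simp: fl.path_append)
  qed
qed

text \<open>Along an ascent-free word no slides occur, so the word can be read off the resulting forest.\<close>

lemma ascent_free_path_root:
  "fl.path (leaf_forest n) w F \<Longrightarrow> ascent_free label_less w \<Longrightarrow> Node c l r \<in> F \<Longrightarrow>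
      (valency l, valency r, c) \<in> set w"
  and ascent_free_path_last:
  "fl.path (leaf_forest n) (w @ [(a, b, u)]) F \<Longrightarrow> ascent_free label_less (w @ [(a, b, u)]) \<Longrightarrow>
    \<exists>ta tb G. fl.path (leaf_forest n) w G \<and> ta \<in> G \<and> tb \<in> G \<and> valency ta = a \<and> valency tb = b \<and>
        a < b \<and>
      Node u ta tb \<notin> G \<and> F = insert (Node u ta tb) (G - {ta, tb})"
proof -
  \<comment> \<open>The two claims depend on each other: the last step is analysed under the root
    claim for \<open>w\<close>, and the root claim for the longer word then follows from this
    analysis.\<close>
  have last: "\<exists>ta tb G. fl.path (leaf_forest n) w G \<and> ta \<in> G \<and> tb \<in> G \<and> valency ta = a \<and>
      valency tb = b \<and> a < b \<and>
      Node u ta tb \<notin> G \<and> F = insert (Node u ta tb) (G - {ta, tb})"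
    if p: "fl.path (leaf_forest n) (w @ [(a, b, u)]) F" and af: "ascent_free label_less (w @ [(a, b, u)])"
      and root: "\<And>G c l r. fl.path (leaf_forest n) w G \<Longrightarrow> Node c l r \<in> G \<Longrightarrow>
          (valency l, valency r, c) \<in> set w"
    for w a b u F
  proof -
    obtain G where G: "fl.path (leaf_forest n) w G" "forest_merge G (a, b, u) F"
      using p by (auto simp: fl.path_append)
    have GF: "G \<in> pointed_lyndon_forests n" using fl.path_closed[OF G(1) fl.s0(1)] .
    obtain ta tb where t: "ta \<in> G" "tb \<in> G" "valency ta = a" "valency tb = b" "a < b"
      "F = insert (insert_tree u ta tb) (G - {ta, tb})" using G(2)
          by (auto simp: forest_merge_iff[OF GF])
    \<comment> \<open>The label of the root of \<open>ta\<close> occurs earlier in the word, so it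
      is not below \<open>(a, b, u)\<close>; both start with \<open>a\<close>, and this comparison
      is what \<open>passes\<close> tests.\<close>
    have "\<not> passes ta b u"
    proof (cases ta)
      case (Node c l r)
      then have "(valency l, valency r, c) \<in> set w" using root G(1) t(1) by blast
      then have "\<not> label_less (valency l, valency r, c) (a, b, u)"
        using af by (auto simp: ascent_free_iff_sorted_wrt sorted_wrt_append)
      moreover have "valency l = a"
        using forest_treeD(1)[OF GF t(1)] t(3) by (auto simp: Node pointed_lyndon_Node)
      ultimately show ?thesis by (auto simp: Node)
    qed simp
    then have "insert_tree u ta tb = Node u ta tb" using t(4) by (simp add: insert_tree_no_pass)
    moreover have "insert_tree u ta tb \<notin> G" using forest_merge_trees(4)[OF GF t(1,2)] t by simp
    ultimately show ?thesis using G(1) t by auto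
  qed
  have root: "fl.path (leaf_forest n) w F \<Longrightarrow> ascent_free label_less w \<Longrightarrow> Node c l r \<in> F \<Longrightarrow>
    (valency l, valency r, c) \<in> set w" for w F c l r
  proof (induction w arbitrary: F c l r rule: rev_induct)
    case Nil
    then show ?case by (auto simp: leaf_forest_def)
  next
    case (snoc x w)
    obtain a b u where x: "x = (a, b, u)" by (cases x)
    have af: "ascent_free label_less w"
      using snoc.prems(2) by (simp add: ascent_free_iff_sorted_wrt sorted_wrt_append)
    obtain ta tb G where G: "fl.path (leaf_forest n) w G" "valency ta = a" "valency tb = b"
      "F = insert (Node u ta tb) (G - {ta, tb})"
      using last[OF snoc.prems(1,2)[unfolded x]] snoc.IH af by blast
    then show ?case using snoc.prems(3) snoc.IH[OF G(1) af] by (auto simp: x)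
  qed
  show "fl.path (leaf_forest n) w F \<Longrightarrow> ascent_free label_less w \<Longrightarrow> Node c l r \<in> F \<Longrightarrow>
    (valency l, valency r, c) \<in> set w" by (rule root)
  show "\<exists>ta tb G. fl.path (leaf_forest n) w G \<and> ta \<in> G \<and> tb \<in> G \<and> valency ta = a \<and> valency tb =
      b \<and> a < b \<and>
      Node u ta tb \<notin> G \<and> F = insert (Node u ta tb) (G - {ta, tb})"
    if "fl.path (leaf_forest n) (w @ [(a, b, u)]) F" "ascent_free label_less (w @ [(a, b, u)])"
    using last[OF that root] that(2) by (auto simp: ascent_free_iff_sorted_wrt sorted_wrt_append)
qed

text \<open>The last letter of an ascent-free word is the label of a root in \<open>F\<close>, and
  its first entry is minimal in the word. This identifies the last merged tree, and removing its
  root restores the forest before that step.\<close>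

lemma ascent_free_path_unique:
  "fl.path (leaf_forest n) v F \<Longrightarrow> fl.path (leaf_forest n) w F \<Longrightarrow>
    ascent_free label_less v \<Longrightarrow> ascent_free label_less w \<Longrightarrow> v = w"
proof (induction v arbitrary: w F rule: rev_induct)
  case Nil
  then have F: "F = leaf_forest n" by simp
  show ?case
  proof (cases w rule: rev_cases)
    case (snoc w' x)
    obtain a b u where x: "x = (a, b, u)" by (cases x)
    obtain ta tb where "Node u ta tb \<in> F"
      using ascent_free_path_last[OF Nil(2,4)[unfolded snoc x]] by blast
    then show ?thesis using F by (auto simp: leaf_forest_def)
  qed simp
next
  case (snoc x v)
  obtain a b u where x: "x = (a, b, u)" by (cases x)
  note p = snoc.prems(1,3)[unfolded x]
  obtain ta tb G where G: "fl.path (leaf_forest n) v G" "ta \<in> G" "tb \<in> G" "valency ta = a"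
      "valency tb = b" "a < b"
      "Node u ta tb \<notin> G" "F = insert (Node u ta tb) (G - {ta, tb})"
    using ascent_free_path_last[OF p] by blast
  show ?case
  proof (cases w rule: rev_cases)
    case Nil
    then show ?thesis using G(8) snoc.prems(2) by (auto simp: leaf_forest_def)
  next
    case w: (snoc w' y)
    obtain c d t where y: "y = (c, d, t)" by (cases y)
    note q = snoc.prems(2,4)[unfolded w y]
    obtain tc td H where H: "fl.path (leaf_forest n) w' H" "tc \<in> H" "td \<in> H" "valency tc = c"
        "valency td = d" "c < d"
        "Node t tc td \<notin> H" "F = insert (Node t tc td) (H - {tc, td})"
      using ascent_free_path_last[OF q] by blast
    have F: "F \<in> pointed_lyndon_forests n" using fl.path_closed[OF snoc.prems(1) fl.s0(1)] .
    have in_F1: "Node u ta tb \<in> F" unfolding G(8) by (rule insertI1)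
    have in_F2: "Node t tc td \<in> F" unfolding H(8) by (rule insertI1)
    note in_F = in_F1 in_F2
    \<comment> \<open>Every root label of \<open>F\<close> occurs in every ascent-free word for
      \<open>F\<close>, so each last letter occurs in the other word, and minimality gives
      \<open>a = c\<close>.\<close>
    have "(a, b, u) \<in> set (w' @ [(c, d, t)])" "(c, d, t) \<in> set (v @ [(a, b, u)])"
      using ascent_free_path_root[OF q in_F(1)] ascent_free_path_root[OF p in_F(2)] G(4,5) H(4,5)
          by auto
    then have "c \<le> a" "a \<le> c"
      using p(2) q(2) by (auto simp: ascent_free_iff_sorted_wrt sorted_wrt_append)
    then have "a = c" by simp
    then have "Node u ta tb = Node t tc td"
      using forest_valency_inj[OF F in_F] G(4-6) H(4-6) by simp
    then have eq: "u = t" "ta = tc" "tb = td" by auto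
    have "G = insert ta (insert tb (F - {Node u ta tb}))" using G(2,3,7,8) by auto
    moreover have "H = insert ta (insert tb (F - {Node u ta tb}))" using H(2,3,7,8) eq by auto
    ultimately have "G = H" by simp
    moreover have "ascent_free label_less v" "ascent_free label_less w'"
      using p(2) q(2) by (auto simp: ascent_free_iff_sorted_wrt sorted_wrt_append)
    ultimately have "v = w'" using snoc.IH G(1) H(1) by blast
    then show ?thesis using eq G(4,5) H(4,5) by (simp add: w x y)
  qed
qed

interpretation fl: reachable_merge_system n "pointed_lyndon_forests n" forest_merge
    "\<lambda>F. valency ` F" "leaf_forest n" for n
  by unfold_locales (rule forest_reachable)

lemma fl_le_eq: "fl.le n = FLyn n"
proof -
  have "(\<exists>l. forest_merge F l F') \<longleftrightarrow> (\<exists>t1\<in>F. \<exists>t2\<in>F. \<exists>u. valency t1 < valency t2 \<and>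
      F' = insert (tree_merge u t1 t2) (F - {t1, t2}))" for F F'
    unfolding forest_merge_def by blast
  then show ?thesis unfolding fl.le_def FLyn_def by simp
qed

text \<open>Sorting gives existence. For uniqueness a word \<open>x\<close> leading to
  \<open>F\<close> is put in front: the sorted extensions end in the same forest and agree by
  uniqueness from the bottom, and then \<open>x\<close> cancels.\<close>

lemma ascent_free_path_ex1:
  assumes F: "F \<in> pointed_lyndon_forests n" and p: "fl.path F w F'"
  shows "\<exists>!v. fl.path F v F' \<and> ascent_free label_less v"
proof (rule ex1I)
  show "fl.path F (sort_word label_less w) F' \<and> ascent_free label_less (sort_word label_less w)"
    using fl.path_sort_word[OF F p] ascent_free_sort_word by simp
  fix v assume v: "fl.path F v F' \<and> ascent_free label_less v"
  obtain x where x: "fl.path (leaf_forest n) x F" using forest_reachable[OF F] ..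
  have "fl.path (leaf_forest n) (x @ v) F'" "fl.path (leaf_forest n) (x @ sort_word label_less w) F'"
    using x v fl.path_sort_word[OF F p] by (auto simp: fl.path_append)
  then have "sort_word label_less (x @ v) = sort_word label_less (x @ sort_word label_less w)"
    using ascent_free_path_unique fl.path_sort_word[OF fl.s0(1)] ascent_free_sort_word by blast
  then show "v = sort_word label_less w"
    using sort_word_eq_cancel v ascent_free_sort_word by blast
qed

section \<open>Duality and isomorphism\<close>

lemma whitney_duals_FLyn: "whitney_duals (FLyn n) (Pi_pointed n)"
proof -
  \<comment> \<open>With this \<open>R\<close>, the words violating it at every place are the
    increasing ones, which are counted by the second Whitney numbers of the pointed
    partitions.\<close>
  have fl: "\<exists>!v. fl.path F v F' \<and> successively (\<lambda>x y. \<not> label_less x y) v"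
    if "F \<in> pointed_lyndon_forests n" "fl.path F w F'" for F F' w
    using ascent_free_path_ex1[OF that] by (simp add: ascent_free_iff_successively)
  show ?thesis
    unfolding whitney_duals_def
    using fl.graded_poset_le[of n] pp.graded_poset_le[of n]
      fl.whitney_le[OF fl] pp.whitney_le[OF increasing_path_ex1]
    by (simp add: fl_le_eq pp_le_eq abs_mult power_abs)
qed

text \<open>Matching the generating steps suffices, since paths in the target lift step by step
  through surjectivity.\<close>

lemma poset_isomorphic_poset_gen:
  assumes f: "bij_betw f A B" and R: "\<And>x y. x \<in> A \<Longrightarrow> y \<in> A \<Longrightarrow> R x y \<longleftrightarrow> R' (f x) (f y)"
  shows "poset_isomorphic (poset_gen A R) (poset_gen B R')"
proof -
  let ?r = "{(x, y). x \<in> A \<and> y \<in> A \<and> R x y}" and ?s = "{(x, y). x \<in> B \<and> y \<in> B \<and> R' x y}"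
  have B: "f x \<in> B" if "x \<in> A" for x using f that by (auto simp: bij_betw_def)
  have "(f x, f y) \<in> ?s\<^sup>*" if "(x, y) \<in> ?r\<^sup>*" for x y
    using that
  proof induction
    case (step y z)
    then have "(f y, f z) \<in> ?s" using R B by auto
    with step.IH show ?case by (rule rtrancl_into_rtrancl)
  qed simp
  moreover have "\<exists>y\<in>A. z = f y \<and> (x, y) \<in> ?r\<^sup>*" if "(f x, z) \<in> ?s\<^sup>*" "x \<in> A" for x z
    using that(1)
  proof induction
    case base
    then show ?case using that(2) by blast
  next
    case (step y z)
    then obtain y' where y': "y' \<in> A" "y = f y'" "(x, y') \<in> ?r\<^sup>*" by blast
    obtain z' where z': "z' \<in> A" "z = f z'" using step.hyps(2) f by (auto simp: bij_betw_def)
    have "(y', z') \<in> ?r" using step.hyps(2) y' z' R by auto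
    with y'(3) have "(x, z') \<in> ?r\<^sup>*" by (rule rtrancl_into_rtrancl)
    with z' show ?case by blast
  qed
  ultimately have "(x, y) \<in> ?r\<^sup>* \<longleftrightarrow> (f x, f y) \<in> ?s\<^sup>*" if "x \<in> A" "y \<in> A" for x y
    using that f by (metis (no_types, lifting) bij_betw_def inj_onD)
  then show ?thesis
    unfolding poset_isomorphic_iff Field_poset_gen using f B
        by (intro exI[of _ f]) (auto simp: poset_gen_def)
qed

text \<open>A forest is sent to its unique ascent-free word, paired with the partition that this
  word reaches. Since both systems read the same words, every admissible pair arises, and merging
  with label \<open>l\<close> means appending \<open>l\<close> and sorting on either side.\<close>

lemma FLyn_isomorphic: "poset_isomorphic (FLyn n) (R_poset label_less lambda_pointed (Pi_pointed n))"
proof -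
  define word where "word F = (THE w. fl.path (leaf_forest n) w F \<and> ascent_free label_less w)" for F
  define pp_of where "pp_of w = (THE x. pp.path (singletons_pp n) w x)" for w
  define f where "f F = (pp_of (word F), word F)" for F
  have word_ex1: "\<exists>!w. fl.path (leaf_forest n) w F \<and> ascent_free label_less w"
    if "F \<in> pointed_lyndon_forests n" for F
    using forest_reachable[OF that] ascent_free_path_ex1[OF fl.s0(1)] by blast
  have word: "fl.path (leaf_forest n) (word F) F" "ascent_free label_less (word F)"
    if "F \<in> pointed_lyndon_forests n" for F
    using theI'[OF word_ex1[OF that]] by (auto simp: word_def)
  have word_eqI: "word F = w" if "fl.path (leaf_forest n) w F" "ascent_free label_less w" for F w
    unfolding word_def
    by (rule the1_equality[OF word_ex1]) (use that fl.path_closed[OF _ fl.s0(1)] in auto)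
  have same_words: "(\<exists>F. fl.path (leaf_forest n) w F) \<longleftrightarrow> (\<exists>x. pp.path (singletons_pp n) w x)" for w
    using fl.path_iff_merge_word[OF fl.s0(1), of n w] pp.path_iff_merge_word[OF pp.s0(1), of n w]
    unfolding fl.s0(2) pp.s0(2) by simp
  have pp_of_eq: "pp_of w = x" if "pp.path (singletons_pp n) w x" for w x
    unfolding pp_of_def by (rule the_equality, rule that) (erule pp.path_det[OF _ that pp.s0(1)])
  have pp_word: "pp.path (singletons_pp n) (word F) (pp_of (word F))"
    if F: "F \<in> pointed_lyndon_forests n" for F
  proof -
    obtain x where "pp.path (singletons_pp n) (word F) x" using word(1)[OF F] same_words by blast
    then show ?thesis using pp_of_eq by simp
  qed
  let ?E = "{(x, w). pp.path (singletons_pp n) w x \<and> ascent_free label_less w}"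
  have E: "R_elems label_less lambda_pointed (Pi_pointed n) = ?E"
    using pp.R_elems_le[of label_less n] by (simp add: pp_le_eq pp_lam_eq)
  have "bij_betw f (pointed_lyndon_forests n) ?E"
    unfolding bij_betw_def
  proof
    show "inj_on f (pointed_lyndon_forests n)"
    proof (rule inj_onI)
      fix F G assume "F \<in> pointed_lyndon_forests n" "G \<in> pointed_lyndon_forests n" "f F = f G"
      then show "F = G" using word(1)[of F] word(1)[of G] fl.path_det[OF _ _ fl.s0(1)]
          by (auto simp: f_def)
    qed
    show "f ` pointed_lyndon_forests n = ?E"
    proof
      show "f ` pointed_lyndon_forests n \<subseteq> ?E" using pp_word word(2) by (auto simp: f_def)
      show "?E \<subseteq> f ` pointed_lyndon_forests n"
      proof clarify
        fix x w assume w: "pp.path (singletons_pp n) w x" "ascent_free label_less w"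
        then obtain F where F: "fl.path (leaf_forest n) w F" using same_words by blast
        then have "F \<in> pointed_lyndon_forests n" using fl.path_closed[OF _ fl.s0(1)] by blast
        moreover have "f F = (x, w)" using word_eqI[OF F w(2)] pp_of_eq[OF w(1)]
            by (simp add: f_def)
        ultimately show "(x, w) \<in> f ` pointed_lyndon_forests n" by force
      qed
    qed
  qed
  moreover have "(\<exists>l. forest_merge F l G) \<longleftrightarrow>
      (case f F of (x, w) \<Rightarrow> \<lambda>(y, v). covers (Pi_pointed n) x y \<and> v =
          sort_word label_less (w @ [lambda_pointed x y])) (f G)"
    if F: "F \<in> pointed_lyndon_forests n" and G: "G \<in> pointed_lyndon_forests n" for F G
  proof -
    define x where "x = pp_of (word F)"
    define y where "y = pp_of (word G)"
    have x: "pp.path (singletons_pp n) (word F) x" "x \<in> pointed_partitions n"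
      using pp_word[OF F] pp.path_closed[OF _ pp.s0(1)] by (auto simp: x_def)
    have covers: "covers (Pi_pointed n) x y \<longleftrightarrow> (\<exists>l. pp_merge x l y)"
      using pp.covers_le_iff[of n x y] x(2) by (simp add: pp_le_eq)
    have lam: "lambda_pointed x y = l" if "pp_merge x l y" for l
      using pp.lam_eq[OF x(2) that] by (simp add: pp_lam_eq)
    \<comment> \<open>In both directions the word extended by \<open>l\<close> is read in one
      system, transferred to the other by \<open>same_words\<close>, and its end is identified by
      determinism after sorting.\<close>
    have "(\<exists>l. forest_merge F l G) \<longleftrightarrow> (\<exists>l. pp_merge x l y \<and> word G =
        sort_word label_less (word F @ [l]))"
    proof
      assume "\<exists>l. forest_merge F l G"
      then obtain l where l: "forest_merge F l G" ..
      then have p: "fl.path (leaf_forest n) (word F @ [l]) G" using word(1)[OF F]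
          by (auto simp: fl.path_append)
      then have wG: "word G = sort_word label_less (word F @ [l])"
        by (intro word_eqI fl.path_sort_word[OF fl.s0(1)] ascent_free_sort_word)
      obtain y' where y': "pp.path (singletons_pp n) (word F @ [l]) y'" using p same_words by blast
      then have "pp_of (word G) = y'"
        unfolding wG by (intro pp_of_eq pp.path_sort_word[OF pp.s0(1)])
      moreover have "pp_merge x l y'"
        using y' x(1) pp.path_det[OF _ _ pp.s0(1)] unfolding pp.path_append by fastforce
      ultimately show "\<exists>l. pp_merge x l y \<and> word G = sort_word label_less (word F @ [l])"
        using wG unfolding y_def by blast
    next
      assume "\<exists>l. pp_merge x l y \<and> word G = sort_word label_less (word F @ [l])"
      then obtain l where l: "pp_merge x l y" "word G = sort_word label_less (word F @ [l])"
          by blast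
      then have "pp.path (singletons_pp n) (word F @ [l]) y" using x(1)
          by (auto simp: pp.path_append)
      then obtain G' where G': "fl.path (leaf_forest n) (word F @ [l]) G'" using same_words by blast
      then have "fl.path (leaf_forest n) (word G) G'"
        unfolding l(2) by (intro fl.path_sort_word[OF fl.s0(1)])
      then have "G' = G" using word(1)[OF G] fl.path_det[OF _ _ fl.s0(1)] by blast
      moreover have "forest_merge F l G'"
        using G' word(1)[OF F] fl.path_det[OF _ _ fl.s0(1)] unfolding fl.path_append by fastforce
      ultimately show "\<exists>l. forest_merge F l G" by blast
    qed
    also have "\<dots> \<longleftrightarrow> covers (Pi_pointed n) x y \<and> word G = sort_word label_less (word F @ [lambda_pointed x y])"
      using covers lam by metis
    finally show ?thesis by (simp add: f_def x_def y_def)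
  qed
  ultimately show ?thesis
    unfolding fl_le_eq[symmetric] fl.le_def R_poset_def E by (rule poset_isomorphic_poset_gen) 
qed

theorem theorem3p8:
  fixes n :: nat
  assumes "n \<ge> 1"
  shows "whitney_duals (FLyn n) (Pi_pointed n) \<and>
         poset_isomorphic (FLyn n) (R_poset label_less lambda_pointed (Pi_pointed n))"
  using whitney_duals_FLyn FLyn_isomorphic ..

end
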